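(* Let $x>0$ and $u\in(0,1)$. Let $B=(B_t)_{t\ge 0}$ be a standard one-dimensional Brownian motion started at $B_0=x$ under the probability measure $\mathsf{P}_x$, and let $\tau=\inf\{t\ge 0: B_t=0\}$. Then the distribution of the random variable $B_{u\tau}$ under $\mathsf{P}_x$, i.e. $y\mapsto \mathsf{P}_x(B_{u\tau}\le y)$, is absolutely continuous with respect to Lebesgue measure, with density given for $y>0$ by $$ p(u,x;y)=\frac{4\sqrt{u(1-u)}\,x\,y^2}{\pi\big\{(y-x)^2(1-u)+y^2u\big\}\big\{(y+x)^2(1-u)+y^2u\big\}}, $$ and equal to $0$ for $y\le 0$.
   Context: $B_{u\tau}$ denotes the value of the Brownian path at the random time $u\tau$, where $\tau$ is the first hitting time of zero (finite $\mathsf{P}_x$-almost surely). *)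

theory Defs
  imports "HOL-Probability.Probability"
begin

text \<open>
  Standard one-dimensional Brownian motion started at \<open>x\<close>. The time index has type \<^typ>\<open>real\<close>;
  only the values at times \<open>t \<ge> 0\<close> are constrained. The second argument of \<^const>\<open>normal_density\<close>
  is the standard deviation, so increments over \<open>[s, t]\<close> have variance \<open>t - s\<close>. Every path is
  continuous, as on the canonical path space; with mere almost sure continuity the process
  evaluated at a random time need not be measurable.
\<close>

locale brownian_motion = prob_space M
  for M :: "'a measure" and B :: "real \<Rightarrow> 'a \<Rightarrow> real" and x :: real +
  assumes random_variable: "\<And>t. 0 \<le> t \<Longrightarrow> random_variable borel (B t)"
    and start: "AE \<omega> in M. B 0 \<omega> = x"
    and independent_increments:
      "\<And>(t :: nat \<Rightarrow> real) n. 0 \<le> t 0 \<Longrightarrow> (\<And>i. i < n \<Longrightarrow> t i < t (Suc i)) \<Longrightarrow>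
        indep_vars (\<lambda>_. borel) (\<lambda>i \<omega>. B (t (Suc i)) \<omega> - B (t i) \<omega>) {..<n}"
    and normal_increments:
      "\<And>s t. 0 \<le> s \<Longrightarrow> s < t \<Longrightarrow>
        distributed M lborel (\<lambda>\<omega>. B t \<omega> - B s \<omega>) (normal_density 0 (sqrt (t - s)))"
    and continuous_paths: "\<And>\<omega>. \<omega> \<in> space M \<Longrightarrow> continuous_on {0..} (\<lambda>t. B t \<omega>)"

text \<open>
  Extended-real valued, so that a path which never visits \<open>a\<close> has hitting time \<open>\<infinity>\<close>.
\<close>

definition hitting_time :: "(real \<Rightarrow> 'a \<Rightarrow> real) \<Rightarrow> real \<Rightarrow> 'a \<Rightarrow> ereal" where
  "hitting_time B a \<omega> = (INF t\<in>{t. 0 \<le> t \<and> B t \<omega> = a}. ereal t)"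

text \<open>
  The value of the path at the random time \<open>u \<tau>\<close>, where \<open>\<tau>\<close> is the first hitting time of zero.
  Since \<^const>\<open>real_of_ereal\<close> sends \<open>\<infinity>\<close> to \<open>0\<close>, the value on the event \<open>\<tau> = \<infinity>\<close> (a null set for
  Brownian motion) is \<open>B\<^sub>0\<close>.
\<close>

definition value_at_fraction_of_hitting_time ::
    "(real \<Rightarrow> 'a \<Rightarrow> real) \<Rightarrow> real \<Rightarrow> 'a \<Rightarrow> real" where
  "value_at_fraction_of_hitting_time B u \<omega> = B (u * real_of_ereal (hitting_time B 0 \<omega>)) \<omega>"

definition fraction_density :: "real \<Rightarrow> real \<Rightarrow> real \<Rightarrow> real" where
  "fraction_density u x y =
    (if y > 0 then
       4 * sqrt (u * (1 - u)) * x * y\<^sup>2 /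
       (pi * ((y - x)\<^sup>2 * (1 - u) + y\<^sup>2 * u) * ((y + x)\<^sup>2 * (1 - u) + y\<^sup>2 * u))
     else 0)"

end

theory Submission
  imports Defs "HOL-Real_Asymp.Real_Asymp"
begin

text \<open>
  For \<open>s < t\<close> the reflection principle gives the law of \<open>B\<^sub>s\<close> on the event that \<open>0\<close> is not hit up to
  time \<open>t\<close>: its density at \<open>y > 0\<close> is the killed kernel times the probability that the path started at
  \<open>y\<close> survives for another time \<open>t - s\<close>. Cutting the time axis into cells of length \<open>1 / n\<close>, evaluating the
  path at \<open>u\<close> times the left endpoint of the cell containing \<open>\<tau>\<close>, and applying Fatou's lemma as
  \<open>n \<rightarrow> \<infinity>\<close> yields, for Lipschitz test functions \<open>f \<ge> 0\<close>, the lower bound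
  \<open>E f(B\<^sub>u\<^sub>\<tau>) \<ge> \<integral>\<integral> f(y) p\<^sup>0\<^sub>u\<^sub>t(x, y) q\<^sub>(\<^sub>1\<^sub>-\<^sub>u\<^sub>)\<^sub>t(y) dt dy\<close>, where \<open>p\<^sup>0\<close> is the killed
  kernel and \<open>q\<close> the hitting density. The \<open>t\<close>-integral is elementary and produces the claimed density. Since
  that density already has total mass \<open>1\<close>, the inequality between the two laws is an equality.
\<close>

subsection \<open>The density\<close>

text \<open>Aiming only at a lower bound keeps the limit easy: the grid sums of killed kernel times
  hitting density need no dominating function in space and time, because Fatou's lemma asks for
  pointwise convergence alone. Almost sure finiteness of \<tau> is never proved separately: paths
  without a zero contribute a nonnegative amount, dropping them preserves the inequality, and the
  total mass 1 of the density settles the matter at the end. The strong Markov property is replaced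
  by the Markov property at grid times. Test functions have to be even, because the reflection
  argument cancels the paths that have visited 0 only for odd functions, and an even
  \<open>f\<close> times the odd function \<open>heat r sgn\<close> is odd. Evenness is no loss, as
  the path is positive at time u \<tau>. Lipschitz continuity pays for looking at the path on the
  grid slightly after its zero. The shape of the density comes from the two Gaussian images: in the
  product of the kernels the power of \<open>r\<close> is \<open>1 / r\<^sup>2\<close>, and the
  integral of \<open>exp (- A / r) / r\<^sup>2\<close> over \<open>r > 0\<close> is
  \<open>1 / A\<close>, with \<open>A\<close> proportional to one of the two quadratics in the
  denominator.\<close>

lemma fraction_density_denominator:
  fixes u x y :: real
  assumes "0 < x" "0 < u" "u < 1"
  shows "(y - x)\<^sup>2 * (1 - u) + y\<^sup>2 * u = (y - x * (1 - u))\<^sup>2 + (x * sqrt (u * (1 - u)))\<^sup>2"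
    and "(y + x)\<^sup>2 * (1 - u) + y\<^sup>2 * u = (y + x * (1 - u))\<^sup>2 + (x * sqrt (u * (1 - u)))\<^sup>2"
    and "0 < (y - x)\<^sup>2 * (1 - u) + y\<^sup>2 * u"
    and "0 < (y + x)\<^sup>2 * (1 - u) + y\<^sup>2 * u"
proof -
  have *: "(x * sqrt (u * (1 - u)))\<^sup>2 = x\<^sup>2 * (u * (1 - u))"
    using assms by (simp add: power_mult_distrib)
  \<comment> \<open>Completing the square in \<open>y\<close>: the remainder
    \<open>x * sqrt (u * (1 - u))\<close> is strictly positive, and it is also the scale of the
    arctangents that appear when the density is integrated.\<close>
  show 1: "(y - x)\<^sup>2 * (1 - u) + y\<^sup>2 * u = (y - x * (1 - u))\<^sup>2 + (x * sqrt (u * (1 - u)))\<^sup>2"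
    and 2: "(y + x)\<^sup>2 * (1 - u) + y\<^sup>2 * u = (y + x * (1 - u))\<^sup>2 + (x * sqrt (u * (1 - u)))\<^sup>2"
    unfolding * by (auto simp: power2_eq_square algebra_simps)
  have "0 < (x * sqrt (u * (1 - u)))\<^sup>2"
    using assms by simp
  then show "0 < (y - x)\<^sup>2 * (1 - u) + y\<^sup>2 * u" "0 < (y + x)\<^sup>2 * (1 - u) + y\<^sup>2 * u"
    unfolding 1 2 by (simp_all add: add_nonneg_pos)
qed

lemma fraction_density_nonneg:
  assumes "0 < x" "0 < u" "u < 1"
  shows "0 \<le> fraction_density u x y"
  using fraction_density_denominator[OF assms] assms
  by (auto simp: fraction_density_def intro!: divide_nonneg_nonneg mult_nonneg_nonneg less_imp_le)

lemma borel_measurable_fraction_density [measurable]: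
  "fraction_density u x \<in> borel_measurable borel"
  unfolding fraction_density_def[abs_def] by measurable

text \<open>Partial fractions: the two quadratics differ by exactly
  \<open>4 * x * y * (1 - u)\<close>. In this form one term belongs to each image of the killed
  kernel, and both the mass of the density and the time integral are computed from it.\<close>

lemma fraction_density_eq_diff:
  assumes "0 < x" "0 < u" "u < 1" "0 < y"
  shows "fraction_density u x y =
    sqrt (u * (1 - u)) * y / (pi * (1 - u)) *
     (1 / ((y - x)\<^sup>2 * (1 - u) + y\<^sup>2 * u) - 1 / ((y + x)\<^sup>2 * (1 - u) + y\<^sup>2 * u))"
proof -
  define a where "a = (y - x)\<^sup>2 * (1 - u) + y\<^sup>2 * u"
  define b where "b = (y + x)\<^sup>2 * (1 - u) + y\<^sup>2 * u"
  have pos: "0 < a" "0 < b"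
    using fraction_density_denominator[OF assms(1-3)] by (auto simp: a_def b_def)
  have ba: "b - a = 4 * x * y * (1 - u)"
    by (simp add: a_def b_def power2_eq_square algebra_simps)
  have "1 / a - 1 / b = (b - a) / (a * b)"
    using pos by (simp add: field_simps)
  also have "\<dots> = 4 * x * y * (1 - u) / (a * b)"
    by (simp add: ba)
  finally have *: "1 / a - 1 / b = 4 * x * y * (1 - u) / (a * b)" .
  show ?thesis
    unfolding a_def[symmetric] b_def[symmetric] *
    unfolding fraction_density_def a_def[symmetric] b_def[symmetric]
    using pos assms by (simp add: field_simps power2_eq_square)
qed

lemma nn_integral_fraction_density:
  assumes "0 < x" "0 < u" "u < 1"
  shows "(\<integral>\<^sup>+y. ennreal (fraction_density u x y) \<partial>lborel) = 1"
proof -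
  define c where "c = 1 - u"
  define s where "s = sqrt (u * c)"
  define a where "a y = (y - x * c)\<^sup>2 + (x * s)\<^sup>2" for y
  define b where "b y = (y + x * c)\<^sup>2 + (x * s)\<^sup>2" for y
  \<comment> \<open>The antiderivative comes from
    \<open>y / a y = (y - x * c) / a y + x * c / a y\<close> and
    \<open>y / b y = (y + x * c) / b y - x * c / b y\<close>: the first summands give the logarithm,
    the second ones the arctangents.\<close>
  define F where "F y = s / (2 * pi * c) * ln (a y / b y)
    + (arctan ((y - x * c) / (x * s)) + arctan ((y + x * c) / (x * s))) / pi" for y
  define f where "f y = s * y / (pi * c) * (1 / a y - 1 / b y)" for y
  have c: "0 < c" and s: "0 < s" and x: "0 < x"
    using assms by (auto simp: c_def s_def)
  have ab: "0 < a y" "0 < b y" for y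
    using x s by (auto simp: a_def b_def add_nonneg_pos)
  have le: "a y \<le> b y" if "0 \<le> y" for y
  proof -
    have "b y - a y = 4 * y * (x * c)"
      by (simp add: a_def b_def power2_eq_square algebra_simps)
    moreover have "0 \<le> 4 * y * (x * c)"
      using that x c by simp
    ultimately show ?thesis by linarith
  qed
  have f_eq: "fraction_density u x y = f y" if "0 < y" for y
    using fraction_density_eq_diff[OF assms that] fraction_density_denominator(1,2)[OF assms, of y]
    by (simp add: f_def a_def b_def s_def c_def)
  have da: "(a has_real_derivative 2 * (y - x * c)) (at y)"
    and db: "(b has_real_derivative 2 * (y + x * c)) (at y)" for y
    unfolding a_def b_def by (auto intro!: derivative_eq_intros)
  have arc: "((\<lambda>y. arctan ((y - d) / (x * s))) has_real_derivative
      x * s / ((y - d)\<^sup>2 + (x * s)\<^sup>2)) (at y)" for d y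
  proof -
    have "((\<lambda>y. arctan ((y - d) / (x * s))) has_real_derivative
      (1 / (x * s)) * inverse (1 + ((y - d) / (x * s))\<^sup>2)) (at y)"
      by (rule derivative_eq_intros refl | use x s in simp)+
    also have "(1 / (x * s)) * inverse (1 + ((y - d) / (x * s))\<^sup>2) =
        x * s / ((y - d)\<^sup>2 + (x * s)\<^sup>2)"
    proof -
      have "1 + ((y - d) / (x * s))\<^sup>2 = ((y - d)\<^sup>2 + (x * s)\<^sup>2) / (x * s)\<^sup>2"
        using x s by (simp add: power_divide add_divide_distrib)
      then show ?thesis
        using x s by (simp add: power2_eq_square)
    qed
    finally show ?thesis .
  qed
  have deriv: "(F has_real_derivative f y) (at y)" for y
  proof -
    have "((\<lambda>y. ln (a y / b y)) has_real_derivative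
        2 * (y - x * c) / a y - 2 * (y + x * c) / b y) (at y)"
    proof -
      have "((\<lambda>y. ln (a y) - ln (b y)) has_real_derivative
          2 * (y - x * c) / a y - 2 * (y + x * c) / b y) (at y)"
        using ab[of y] by (auto intro!: derivative_eq_intros da db)
      moreover have "ln (a y / b y) = ln (a y) - ln (b y)" for y
        using ab[of y] by (simp add: ln_div)
      ultimately show ?thesis by simp
    qed
    then have "(F has_real_derivative
        s / (2 * pi * c) * (2 * (y - x * c) / a y - 2 * (y + x * c) / b y)
         + (x * s / a y + x * s / b y) / pi) (at y)"
      unfolding F_def[abs_def] using arc[of "x * c" y] arc[of "- (x * c)" y]
      by (intro DERIV_add DERIV_cmult DERIV_cdivide) (simp_all add: a_def b_def)
    also have "s / (2 * pi * c) * (2 * (y - x * c) / a y - 2 * (y + x * c) / b y)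
         + (x * s / a y + x * s / b y) / pi = f y"
      unfolding f_def using ab[of y] c by (simp add: field_simps)
    finally show ?thesis .
  qed
  \<comment> \<open>\<open>a y / b y\<close> tends to 1, so the logarithm disappears at infinity and
    the whole mass is \<open>(pi / 2 + pi / 2) / pi\<close>. At 0 the arctangents cancel and
    \<open>a 0 = b 0\<close>.\<close>
  have lim: "(F \<longlongrightarrow> 1) at_top"
  proof -
    have "((\<lambda>y. arctan ((y - d) / (x * s))) \<longlongrightarrow> pi / 2) at_top" for d
    proof (rule filterlim_compose[OF tendsto_arctan_at_top])
      show "filterlim (\<lambda>y. (y - d) / (x * s)) at_top at_top"
        using x s by real_asymp
    qed
    from this[of "x * c"] this[of "- (x * c)"]
    have 1: "((\<lambda>y. (arctan ((y - x * c) / (x * s)) + arctan ((y + x * c) / (x * s))) / pi)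
        \<longlongrightarrow> (pi / 2 + pi / 2) / pi) at_top"
      by (intro tendsto_intros) auto
    have "((\<lambda>y. a y / b y) \<longlongrightarrow> 1) at_top"
      unfolding a_def b_def by real_asymp
    then have "((\<lambda>y. ln (a y / b y)) \<longlongrightarrow> ln 1) at_top"
      by (intro tendsto_intros) auto
    then have "((\<lambda>y. s / (2 * pi * c) * ln (a y / b y)) \<longlongrightarrow> s / (2 * pi * c) * ln 1) at_top"
      by (rule tendsto_mult_left)
    from tendsto_add[OF this 1] show ?thesis
      by (simp add: F_def[abs_def])
  qed
  have "F 0 = 0"
    by (simp add: F_def a_def b_def arctan_minus)
  \<comment> \<open>The closed half line is correct because \<open>f 0 = 0\<close>.\<close>
  have "(\<integral>\<^sup>+y. ennreal (fraction_density u x y) \<partial>lborel) =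
      (\<integral>\<^sup>+y. ennreal (f y) * indicator {0..} y \<partial>lborel)"
  proof (intro nn_integral_cong)
    fix y :: real
    consider "y < 0" | "y = 0" | "0 < y" by linarith
    then show "ennreal (fraction_density u x y) = ennreal (f y) * indicator {0..} y"
    proof cases
      case 3
      then show ?thesis by (simp add: f_eq)
    qed (simp_all add: fraction_density_def f_def)
  qed
  also have "\<dots> = ennreal (1 - F 0)"
  proof (rule nn_integral_FTC_atLeast[OF _ deriv _ lim])
    show "f \<in> borel_measurable borel"
      unfolding f_def[abs_def] a_def b_def by measurable
    show "0 \<le> f y" if "0 \<le> y" for y
      unfolding f_def using that c s ab[of y] le[OF that]
      by (intro mult_nonneg_nonneg) (auto simp: field_simps)
  qed
  finally show ?thesis
    by (simp add: \<open>F 0 = 0\<close>)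
qed

subsection \<open>The killed kernel and the hitting density\<close>

text \<open>The classical density, in the time variable \<open>r\<close>, of the first zero of
  Brownian motion started at \<open>y > 0\<close>. It is minus the \<open>r\<close>-derivative of
  the survival probability \<open>heat r sgn y\<close>.\<close>

definition hit_density :: "real \<Rightarrow> real \<Rightarrow> real" where
  "hit_density r y = y / sqrt (2 * pi * r ^ 3) * exp (- y\<^sup>2 / (2 * r))"

text \<open>Method of images: the transition density of Brownian motion killed at 0, with a negative
  source at the mirror point \<open>- x\<close>.\<close>

definition killed_density :: "real \<Rightarrow> real \<Rightarrow> real \<Rightarrow> real" where
  "killed_density s x y = normal_density x (sqrt s) y - normal_density (- x) (sqrt s) y"

lemma borel_measurable_hit_density [measurable]:
  assumes [measurable]: "f \<in> borel_measurable M" "g \<in> borel_measurable M"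
  shows "(\<lambda>z. hit_density (f z) (g z)) \<in> borel_measurable M"
  unfolding hit_density_def by measurable

lemma borel_measurable_killed_density [measurable]:
  assumes [measurable]: "f \<in> borel_measurable M" "g \<in> borel_measurable M"
  shows "(\<lambda>z. killed_density (f z) x (g z)) \<in> borel_measurable M"
  unfolding killed_density_def normal_density_def by measurable

lemma hit_density_nonneg: "0 \<le> r \<Longrightarrow> 0 \<le> y \<Longrightarrow> 0 \<le> hit_density r y"
  by (simp add: hit_density_def)

lemma killed_density_nonneg:
  assumes "0 \<le> s" "0 \<le> x" "0 \<le> y"
  shows "0 \<le> killed_density s x y"
proof -
  have "(y - x)\<^sup>2 \<le> (y + x)\<^sup>2"
    using assms by (simp add: power2_eq_square algebra_simps)
  then have "- (y + x)\<^sup>2 / (2 * s) \<le> - (y - x)\<^sup>2 / (2 * s)"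
    using assms by (intro divide_right_mono) auto
  then have "exp (- (y + x)\<^sup>2 / (2 * s)) \<le> exp (- (y - x)\<^sup>2 / (2 * s))"
    by simp
  then show ?thesis
    using assms unfolding killed_density_def normal_density_def
    by (auto intro!: divide_right_mono)
qed

text \<open>The normalisations carry \<open>r\<close> to the powers 1/2 and 3/2, which multiply to
  \<open>r\<^sup>2\<close>, and each pair of exponents merges into a single multiple of
  \<open>1 / r\<close>. What remains is an exact derivative in \<open>r\<close>.\<close>

lemma killed_density_mult_hit_density:
  assumes "0 < u" "0 < c" "0 < r"
  shows "killed_density (u * r) x y * hit_density (c * r) y =
    y / (2 * pi * c * sqrt (u * c)) *
     ((exp (- ((y - x)\<^sup>2 / (2 * u) + y\<^sup>2 / (2 * c)) / r)
      - exp (- ((y + x)\<^sup>2 / (2 * u) + y\<^sup>2 / (2 * c)) / r)) / r\<^sup>2)"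
proof -
  have e: "exp (- z\<^sup>2 / (2 * (u * r))) * exp (- y\<^sup>2 / (2 * (c * r))) =
      exp (- (z\<^sup>2 / (2 * u) + y\<^sup>2 / (2 * c)) / r)" for z
    using assms by (simp add: exp_add[symmetric] field_simps)
  have "sqrt (2 * pi * (u * r)) * sqrt (2 * pi * (c * r) ^ 3) =
      sqrt ((2 * pi * c * r\<^sup>2)\<^sup>2 * (u * c))"
    unfolding real_sqrt_mult[symmetric]
    by (intro arg_cong[where f=sqrt]) (simp add: power2_eq_square power3_eq_cube)
  also have "\<dots> = 2 * pi * c * r\<^sup>2 * sqrt (u * c)"
    using assms by (simp add: real_sqrt_mult)
  finally have r: "sqrt (2 * pi * (u * r)) * sqrt (2 * pi * (c * r) ^ 3) =
    2 * pi * c * r\<^sup>2 * sqrt (u * c)" .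
  have "killed_density (u * r) x y * hit_density (c * r) y =
    y * ((exp (- (y - x)\<^sup>2 / (2 * (u * r))) - exp (- (y + x)\<^sup>2 / (2 * (u * r))))
       * exp (- y\<^sup>2 / (2 * (c * r))))
      / (sqrt (2 * pi * (u * r)) * sqrt (2 * pi * (c * r) ^ 3))"
    unfolding killed_density_def hit_density_def normal_density_def
    using assms by (simp add: diff_divide_distrib[symmetric] mult_ac)
  also have "\<dots> = y * (exp (- ((y - x)\<^sup>2 / (2 * u) + y\<^sup>2 / (2 * c)) / r)
      - exp (- ((y + x)\<^sup>2 / (2 * u) + y\<^sup>2 / (2 * c)) / r))
      / (2 * pi * c * r\<^sup>2 * sqrt (u * c))"
    unfolding left_diff_distrib e r ..
  finally show ?thesis
    by (simp add: mult_ac)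
qed

lemma has_real_derivative_exp_div:
  assumes "A \<noteq> 0" "r \<noteq> 0"
  shows "((\<lambda>r. exp (- A / r) / A) has_real_derivative exp (- A / r) / r\<^sup>2) (at r)"
proof -
  have "((\<lambda>r. exp (- A / r) / A) has_real_derivative
     exp (- A / r) * (A / r\<^sup>2) / A) (at r)"
    using assms by (auto intro!: derivative_eq_intros simp: power2_eq_square)
  then show ?thesis
    using assms by simp
qed

lemma nn_integral_exp_diff_ge:
  assumes "0 < A" "A \<le> B" "0 \<le> K"
  shows "ennreal (K * (1 / A - 1 / B)) \<le>
    (\<integral>\<^sup>+r. indicator {0<..} r * ennreal (K * ((exp (- A / r) - exp (- B / r)) / r\<^sup>2)) \<partial>lborel)"
    (is "_ \<le> ?I")
proof -
  \<comment> \<open>\<open>F\<close> is an antiderivative on \<open>r > 0\<close>. The integrand is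
    only handled from \<open>e > 0\<close> on; \<open>F\<close> tends to 0 at \<open>0+\<close> and
    to \<open>K * (1 / A - 1 / B)\<close> at infinity, so letting \<open>e\<close> shrink gives the
    bound, which is the only direction needed.\<close>
  define F where "F r = K * (exp (- A / r) / A - exp (- B / r) / B)" for r
  have bound: "ennreal (K * (1 / A - 1 / B) - F e) \<le> ?I" if "0 < e" for e
  proof -
    have "(\<integral>\<^sup>+r. ennreal (K * ((exp (- A / r) - exp (- B / r)) / r\<^sup>2)) * indicator {e..} r \<partial>lborel) =
      ennreal (K * (1 / A - 1 / B) - F e)"
    proof (rule nn_integral_FTC_atLeast)
      show "(\<lambda>r. K * ((exp (- A / r) - exp (- B / r)) / r\<^sup>2)) \<in> borel_measurable borel"
        by measurable
      show "(F has_real_derivative K * ((exp (- A / r) - exp (- B / r)) / r\<^sup>2)) (at r)"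
        if "e \<le> r" for r
      proof -
        have "r \<noteq> 0" "A \<noteq> 0" "B \<noteq> 0"
          using that \<open>0 < e\<close> assms by auto
        then have "(F has_real_derivative K * (exp (- A / r) / r\<^sup>2 - exp (- B / r) / r\<^sup>2)) (at r)"
          unfolding F_def[abs_def]
          by (intro DERIV_cmult DERIV_diff has_real_derivative_exp_div)
        then show ?thesis
          by (simp add: diff_divide_distrib)
      qed
      show "0 \<le> K * ((exp (- A / r) - exp (- B / r)) / r\<^sup>2)" if "e \<le> r" for r
        using assms that \<open>0 < e\<close> by (auto simp: divide_right_mono intro!: mult_nonneg_nonneg)
      have "((\<lambda>r. exp (- A / r)) \<longlongrightarrow> 1) at_top" for A :: real
        by real_asymp
      then show "(F \<longlongrightarrow> K * (1 / A - 1 / B)) at_top"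
        unfolding F_def[abs_def] using assms by (intro tendsto_intros) auto
    qed
    moreover have "\<dots> \<le> ?I"
      using calculation[symmetric] \<open>0 < e\<close>
      by (auto intro!: nn_integral_mono split: split_indicator)
    ultimately show ?thesis
      by simp
  qed
  have "((\<lambda>r. exp (- A / r)) \<longlongrightarrow> 0) (at_right 0)" if "0 < A" for A :: real
    using that by real_asymp
  then have "(F \<longlongrightarrow> K * (0 / A - 0 / B)) (at_right 0)"
    unfolding F_def[abs_def] using assms by (intro tendsto_intros) auto
  then have "((\<lambda>e. K * (1 / A - 1 / B) - F e) \<longlongrightarrow> K * (1 / A - 1 / B) - K * (0 / A - 0 / B))
      (at_right 0)"
    by (intro tendsto_intros)
  then have "((\<lambda>e. ennreal (K * (1 / A - 1 / B) - F e)) \<longlongrightarrow> ennreal (K * (1 / A - 1 / B)))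
      (at_right 0)"
    by (intro tendsto_ennrealI) simp
  then show ?thesis
  proof (rule tendsto_upperbound)
    show "\<forall>\<^sub>F e in at_right 0. ennreal (K * (1 / A - 1 / B) - F e) \<le> ?I"
      using bound by (auto simp: eventually_at_filter)
  qed simp
qed

lemma fraction_density_le_nn_integral:
  assumes "0 < x" "0 < u" "u < 1" "0 < y"
  shows "ennreal (fraction_density u x y) \<le>
    (\<integral>\<^sup>+r. indicator {0<..} r *
       ennreal (killed_density (u * r) x y * hit_density ((1 - u) * r) y) \<partial>lborel)"
proof -
  define c where "c = 1 - u"
  define A where "A = (y - x)\<^sup>2 / (2 * u) + y\<^sup>2 / (2 * c)"
  define B where "B = (y + x)\<^sup>2 / (2 * u) + y\<^sup>2 / (2 * c)"
  define K where "K = y / (2 * pi * c * sqrt (u * c))"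
  have c: "0 < c" using assms by (simp add: c_def)
  have K: "0 \<le> K" using assms c by (simp add: K_def)
  have A: "0 < A"
    using assms c by (auto simp: A_def intro!: add_nonneg_pos)
  have "(y - x)\<^sup>2 \<le> (y + x)\<^sup>2"
    using assms by (simp add: power2_eq_square algebra_simps)
  then have AB: "A \<le> B"
    using assms c by (auto simp: A_def B_def intro!: divide_right_mono)
  define a where "a = (y - x)\<^sup>2 * c + y\<^sup>2 * u"
  define b where "b = (y + x)\<^sup>2 * c + y\<^sup>2 * u"
  \<comment> \<open>Clearing denominators turns the exponents into the two quadratics of the
    density. The common factor \<open>2 * (u * c)\<close>, combined with \<open>K\<close>, gives the
    prefactor found by partial fractions.\<close>
  have "A = a / (2 * (u * c))" "B = b / (2 * (u * c))"
    using assms c by (auto simp: A_def B_def a_def b_def field_simps)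
  then have AB_eq: "1 / A - 1 / B = (2 * (u * c)) * (1 / a - 1 / b)"
    by (simp add: algebra_simps)
  have "sqrt (u * c) * sqrt (u * c) = u * c"
    using assms c by simp
  then have K_eq: "K * (2 * (u * c)) = sqrt (u * c) * y / (pi * c)"
    using assms c by (simp add: K_def field_simps)
  have "K * (1 / A - 1 / B) = fraction_density u x y"
    using fraction_density_eq_diff[OF assms]
    unfolding AB_eq c_def[symmetric] a_def[symmetric] b_def[symmetric] K_eq[symmetric]
    by (simp only: mult.assoc)
  then have "ennreal (fraction_density u x y) \<le>
      (\<integral>\<^sup>+r. indicator {0<..} r * ennreal (K * ((exp (- A / r) - exp (- B / r)) / r\<^sup>2)) \<partial>lborel)"
    using nn_integral_exp_diff_ge[OF A AB K] by simp
  also have "\<dots> = (\<integral>\<^sup>+r. indicator {0<..} r *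
       ennreal (killed_density (u * r) x y * hit_density ((1 - u) * r) y) \<partial>lborel)"
  proof (intro nn_integral_cong)
    fix r :: real
    show "indicator {0<..} r * ennreal (K * ((exp (- A / r) - exp (- B / r)) / r\<^sup>2)) =
      indicator {0<..} r * ennreal (killed_density (u * r) x y * hit_density ((1 - u) * r) y)"
      using killed_density_mult_hit_density[OF assms(2) c, of r x y]
      by (auto simp: A_def B_def K_def c_def split: split_indicator)
  qed
  finally show ?thesis .
qed

subsection \<open>The heat semigroup\<close>

definition gauss :: "real measure" where
  "gauss = density lborel (\<lambda>z. ennreal (std_normal_density z))"

lemma sets_gauss [measurable_cong, simp]: "sets gauss = sets borel"
  by (simp add: gauss_def)

lemma space_gauss [simp]: "space gauss = UNIV"
  by (simp add: gauss_def)

interpretation gauss: prob_space gauss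
  unfolding gauss_def by (rule prob_space_normal_density) simp

lemma integral_gauss:
  fixes f :: "real \<Rightarrow> real"
  assumes [measurable]: "f \<in> borel_measurable borel"
  shows "(\<integral>z. f z \<partial>gauss) = (\<integral>z. std_normal_density z * f z \<partial>lborel)"
  unfolding gauss_def by (subst integral_density) auto

lemma integral_gauss_uminus:
  fixes f :: "real \<Rightarrow> real"
  assumes [measurable]: "f \<in> borel_measurable borel"
  shows "(\<integral>z. f (- z) \<partial>gauss) = (\<integral>z. f z \<partial>gauss)"
  using lborel_integral_real_affine[of "-1" "\<lambda>z. std_normal_density z * f z" 0]
  by (simp add: integral_gauss normal_density_def)

lemma integrable_gauss_bounded:
  fixes f :: "real \<Rightarrow> real"
  assumes "f \<in> borel_measurable borel" "\<And>z. \<bar>f z\<bar> \<le> C"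
  shows "integrable gauss f"
  using assms by (intro gauss.integrable_const_bound[of _ C]) auto

text \<open>Averaging over a fixed standard normal variable, instead of integrating against a kernel
  that depends on \<open>r\<close>, includes \<open>r = 0\<close> as the identity and lets bounds,
  oddness and Lipschitz constants pass directly from \<open>g\<close>.\<close>

definition heat :: "real \<Rightarrow> (real \<Rightarrow> real) \<Rightarrow> real \<Rightarrow> real" where
  "heat r g y = (\<integral>z. g (y + sqrt r * z) \<partial>gauss)"

lemma borel_measurable_heat [measurable]:
  assumes [measurable]: "g \<in> borel_measurable borel"
  shows "heat r g \<in> borel_measurable borel"
  unfolding heat_def[abs_def]
  by (rule gauss.borel_measurable_lebesgue_integral) measurable

lemma heat_0 [simp]: "heat 0 g y = g y"
  by (simp add: heat_def gauss.prob_space[simplified])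

lemma heat_uminus:
  assumes [measurable]: "g \<in> borel_measurable borel"
    and "\<And>y. g (- y) = - g y"
  shows "heat r g (- y) = - heat r g y"
proof -
  have "heat r g (- y) = (\<integral>z. g (- y + sqrt r * (- z)) \<partial>gauss)"
    unfolding heat_def by (subst integral_gauss_uminus[symmetric]) auto
  also have "\<dots> = (\<integral>z. - g (y + sqrt r * z) \<partial>gauss)"
    by (intro Bochner_Integration.integral_cong) (auto simp: assms(2)[symmetric])
  finally show ?thesis
    by (simp add: heat_def)
qed

lemma abs_heat_le:
  assumes [measurable]: "g \<in> borel_measurable borel"
    and "\<And>y. \<bar>g y\<bar> \<le> C"
  shows "\<bar>heat r g y\<bar> \<le> C"
proof -
  have "0 \<le> C"
    using assms(2)[of 0] by linarith
  have "\<bar>heat r g y\<bar> \<le> (\<integral>z. \<bar>g (y + sqrt r * z)\<bar> \<partial>gauss)"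
    unfolding heat_def by (rule integral_abs_bound)
  also have "\<dots> \<le> (\<integral>z. C \<partial>gauss)"
    using assms(2) \<open>0 \<le> C\<close> by (intro integral_mono integrable_gauss_bounded[of _ C]) auto
  also have "\<dots> = C"
    using gauss.prob_space by simp
  finally show ?thesis .
qed

lemma lipschitz_on_heat:
  assumes g: "L-lipschitz_on UNIV g" and bdd: "\<And>y. \<bar>g y\<bar> \<le> C"
  shows "L-lipschitz_on UNIV (heat r g)"
proof (rule lipschitz_onI)
  have [measurable]: "g \<in> borel_measurable borel"
    using g by (intro borel_measurable_continuous_onI lipschitz_on_continuous_on)
  show "0 \<le> L"
    using g by (rule lipschitz_on_nonneg)
  fix a b :: real
  have "heat r g a - heat r g b = (\<integral>z. g (a + sqrt r * z) - g (b + sqrt r * z) \<partial>gauss)"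
    unfolding heat_def using bdd
    by (intro Bochner_Integration.integral_diff[symmetric] integrable_gauss_bounded[of _ C]) auto
  then have "\<bar>heat r g a - heat r g b\<bar> \<le> (\<integral>z. \<bar>g (a + sqrt r * z) - g (b + sqrt r * z)\<bar> \<partial>gauss)"
    by (simp add: integral_abs_bound)
  also have "\<dots> \<le> (\<integral>z. L * \<bar>a - b\<bar> \<partial>gauss)"
  proof (rule integral_mono)
    have le: "\<bar>g (a + sqrt r * z) - g (b + sqrt r * z)\<bar> \<le> L * \<bar>a - b\<bar>" for z
      using lipschitz_onD[OF g, of "a + sqrt r * z" "b + sqrt r * z"] by (simp add: dist_real_def)
    then show "\<bar>g (a + sqrt r * z) - g (b + sqrt r * z)\<bar> \<le> L * \<bar>a - b\<bar>" for z .
    show "integrable gauss (\<lambda>z. \<bar>g (a + sqrt r * z) - g (b + sqrt r * z)\<bar>)"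
      using le by (intro integrable_gauss_bounded[of _ "L * \<bar>a - b\<bar>"]) auto
  qed simp
  also have "\<dots> = L * \<bar>a - b\<bar>"
    using gauss.prob_space by simp
  finally show "dist (heat r g a) (heat r g b) \<le> L * dist a b"
    by (simp add: dist_real_def)
qed

lemma heat_eq_lborel:
  assumes [measurable]: "g \<in> borel_measurable borel" and "0 < r"
  shows "heat r g y = (\<integral>w. normal_density 0 (sqrt r) w * g (y + w) \<partial>lborel)"
proof -
  have "normal_density 0 (sqrt r) (sqrt r * z) * sqrt r = std_normal_density z" for z
    using \<open>0 < r\<close> by (simp add: normal_density_def real_sqrt_mult power_mult_distrib field_simps)
  then have *: "std_normal_density z * c = sqrt r * (normal_density 0 (sqrt r) (sqrt r * z) * c)"
    for z c by (metis mult.assoc mult.commute)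
  show ?thesis
    using \<open>0 < r\<close>
      lborel_integral_real_affine[of "sqrt r" "\<lambda>w. normal_density 0 (sqrt r) w * g (y + w)" 0]
    by (simp add: heat_def integral_gauss *)
qed

lemma heat_eq_lborel':
  assumes [measurable]: "g \<in> borel_measurable borel" and "0 < r"
  shows "heat r g y = (\<integral>w. normal_density y (sqrt r) w * g w \<partial>lborel)"
proof -
  have "normal_density y (sqrt r) (y + w) = normal_density 0 (sqrt r) w" for w
    by (simp add: normal_density_def)
  then show ?thesis
    using lborel_integral_real_affine[of 1 "\<lambda>w. normal_density y (sqrt r) w * g w" y]
    by (simp add: heat_eq_lborel[OF assms])
qed

lemma heat_tendsto:
  assumes [measurable]: "\<And>m. g m \<in> borel_measurable borel" "g' \<in> borel_measurable borel"
    and bdd: "\<And>m y. \<bar>g m y\<bar> \<le> C"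
    and lim: "\<And>y. (\<lambda>m. g m y) \<longlonglongrightarrow> g' y"
  shows "(\<lambda>m. heat r (g m) y) \<longlonglongrightarrow> heat r g' y"
  unfolding heat_def
  using bdd by (intro integral_dominated_convergence[of _ _ _ "\<lambda>_. C"])
    (auto intro!: lim)

text \<open>For \<open>y > 0\<close> the number \<open>heat r sgn y\<close> is the probability that
  a path from \<open>y\<close> has no zero up to time \<open>r\<close>, so its decrease over
  \<open>[a, b]\<close> must be the hitting mass of that interval. Here this is pure calculus: both
  sides are increments of \<open>2 * P (- y / sqrt r)\<close>, with \<open>P\<close> an
  antiderivative of the standard normal density.\<close>

lemma heat_sgn_diff:
  assumes "0 < a" "a \<le> b" "0 < y"
  shows "(\<integral>\<^sup>+r. ennreal (hit_density r y) * indicator {a..b} r \<partial>lborel) =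
      ennreal (heat a sgn y - heat b sgn y)" (is ?eq)
    and "heat b sgn y \<le> heat a sgn y" (is ?le)
proof -
  have "\<exists>P. \<forall>z::real. -\<infinity> < ereal z \<longrightarrow> ereal z < \<infinity> \<longrightarrow>
      (P has_vector_derivative std_normal_density z) (at z)"
    by (rule einterval_antiderivative)
      (auto simp: normal_density_def intro!: continuous_intros)
  then obtain P where P: "(P has_real_derivative std_normal_density z) (at z)" for z
    by (auto simp: has_real_derivative_iff_has_vector_derivative)
  have heat_diff: "heat a sgn y - heat b sgn y = 2 * P (- y / sqrt b) - 2 * P (- y / sqrt a)"
  proof -
    have sgn: "heat r sgn y = (\<integral>z. sgn (y / sqrt r + z) \<partial>gauss)" if "0 < r" for r
      unfolding heat_def
    proof (intro Bochner_Integration.integral_cong refl)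
      fix z
      have "y + sqrt r * z = sqrt r * (y / sqrt r + z)"
        using that by (simp add: field_simps)
      then show "sgn (y + sqrt r * z) = sgn (y / sqrt r + z)"
        using that by (simp only: sgn_mult) simp
    qed
    have le: "- y / sqrt a \<le> - y / sqrt b"
      using assms by (simp add: frac_le)
    have "AE z in lborel. z \<noteq> - y / sqrt a \<and> z \<noteq> - y / sqrt b"
      by (intro AE_conjI AE_lborel_singleton)
    have "heat a sgn y - heat b sgn y =
        (\<integral>z. sgn (y / sqrt a + z) - sgn (y / sqrt b + z) \<partial>gauss)"
      using assms by (simp add: sgn, intro Bochner_Integration.integral_diff[symmetric]
          integrable_gauss_bounded[of _ 1]) (auto simp: abs_sgn_eq)
    also have "\<dots> = (\<integral>z. std_normal_density z * (sgn (y / sqrt a + z) - sgn (y / sqrt b + z)) \<partial>lborel)"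
      by (intro integral_gauss) auto
    \<comment> \<open>The two signs differ, by 2, only for \<open>z\<close> between the two
      thresholds. At the thresholds themselves \<open>sgn\<close> is 0, which concerns a null
      set.\<close>
    also have "\<dots> = (\<integral>z. 2 * (std_normal_density z *
        indicator {- y / sqrt a .. - y / sqrt b} z) \<partial>lborel)"
    proof (intro integral_cong_AE)
      show "AE z in lborel. std_normal_density z * (sgn (y / sqrt a + z) - sgn (y / sqrt b + z)) =
          2 * (std_normal_density z * indicator {- y / sqrt a .. - y / sqrt b} z)"
        using \<open>AE z in lborel. z \<noteq> - y / sqrt a \<and> z \<noteq> - y / sqrt b\<close>
      proof eventually_elim
        case (elim z)
        then show ?case
          using le by (auto simp: sgn_if split: split_indicator)
      qed
    qed auto
    also have "\<dots> = 2 * (P (- y / sqrt b) - P (- y / sqrt a))"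
      using le by (simp add: integral_FTC_Icc_nonneg[OF _ P])
    finally show ?thesis by simp
  qed
  define F where "F r = 2 * P (- y / sqrt r)" for r
  have "(F has_real_derivative hit_density r y) (at r)" if "0 < r" for r
  proof -
    have *: "((\<lambda>r. - y / sqrt r) has_real_derivative y / (2 * (r * sqrt r))) (at r)"
      using that by (auto intro!: derivative_eq_intros simp: field_simps)
    have "(F has_real_derivative 2 * (std_normal_density (- y / sqrt r) * (y / (2 * (r * sqrt r))))) (at r)"
      unfolding F_def by (intro DERIV_cmult DERIV_chain2[OF P *])
    moreover have "2 * (std_normal_density (- y / sqrt r) * (y / (2 * (r * sqrt r)))) = hit_density r y"
      using that
      by (simp add: normal_density_def hit_density_def real_sqrt_mult power3_eq_cube power_divide mult_ac)
    ultimately show ?thesis by simp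
  qed
  then have F: "(F has_real_derivative hit_density r y) (at r)" "0 \<le> hit_density r y" if "a \<le> r" for r
    using that assms by (auto simp: hit_density_nonneg)
  then show ?eq
    using nn_integral_FTC_Icc[of "\<lambda>r. hit_density r y" a b F] assms
    by (simp add: heat_diff F_def)
  have "F a \<le> F b"
    using F assms by (intro DERIV_nonneg_imp_nondecreasing[of a b F]) auto
  then show ?le
    using heat_diff by (simp add: F_def)
qed

lemma nn_integral_hit_density_shift:
  assumes "s < t" "t \<le> t'" "0 < y"
  shows "(\<integral>\<^sup>+r. indicator {t<..t'} r * ennreal (hit_density (r - s) y) \<partial>lborel) =
    ennreal (heat (t - s) sgn y - heat (t' - s) sgn y)"
proof -
  have "(\<integral>\<^sup>+r. indicator {t<..t'} r * ennreal (hit_density (r - s) y) \<partial>lborel) =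
      (\<integral>\<^sup>+r. ennreal (hit_density (r - s) y) * indicator {t..t'} r \<partial>lborel)"
    using AE_lborel_singleton[of t]
    by (intro nn_integral_cong_AE) (auto elim!: eventually_mono split: split_indicator)
  also have "\<dots> = (\<integral>\<^sup>+r. ennreal (hit_density r y) * indicator {t - s..t' - s} r \<partial>lborel)"
    by (subst nn_integral_real_affine[of _ 1 s])
      (auto intro!: nn_integral_cong split: split_indicator)
  also have "\<dots> = ennreal (heat (t - s) sgn y - heat (t' - s) sgn y)"
    using assms by (intro heat_sgn_diff) auto
  finally show ?thesis .
qed

text \<open>Folding the Gaussian integral of an odd function onto the half line is what turns the free
  kernel into the killed one.\<close>

lemma heat_odd_eq_killed:
  assumes "0 < s" and [measurable]: "g \<in> borel_measurable borel"
    and odd: "\<And>y. g (- y) = - g y" and bdd: "\<And>y. \<bar>g y\<bar> \<le> C"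
  shows "integrable lborel (\<lambda>w. indicator {0<..} w * (killed_density s x w * g w))"
    and "heat s g x = (\<integral>w. indicator {0<..} w * (killed_density s x w * g w) \<partial>lborel)"
proof -
  have C: "0 \<le> C"
    using bdd[of 0] by linarith
  have int: "integrable lborel (\<lambda>w. indicator A w * (normal_density m (sqrt s) w * g w))"
    if [measurable]: "A \<in> sets borel" for A m
  proof (rule Bochner_Integration.integrable_bound)
    show "integrable lborel (\<lambda>w. C * normal_density m (sqrt s) w)"
      using \<open>0 < s\<close> by (intro integrable_mult_right integrable_normal_density) simp
    show "AE w in lborel. norm (indicator A w * (normal_density m (sqrt s) w * g w))
        \<le> norm (C * normal_density m (sqrt s) w)"
      using bdd C \<open>0 < s\<close>
      by (intro AE_I2) (auto simp: abs_mult mult.commute[of C] intro!: mult_left_mono split: split_indicator)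
  qed measurable
  have eq: "indicator {0<..} w * (killed_density s x w * g w) =
      indicator {0<..} w * (normal_density x (sqrt s) w * g w)
      - indicator {0<..} w * (normal_density (- x) (sqrt s) w * g w)" for w
    by (simp add: killed_density_def algebra_simps)
  show "integrable lborel (\<lambda>w. indicator {0<..} w * (killed_density s x w * g w))"
    unfolding eq by (intro Bochner_Integration.integrable_diff int) auto
  have "g 0 = 0"
    using odd[of 0] by simp
  then have split: "normal_density x (sqrt s) w * g w =
      indicator {0<..} w * (normal_density x (sqrt s) w * g w)
      + indicator {..<0} w * (normal_density x (sqrt s) w * g w)" for w
    by (cases w "0 :: real" rule: linorder_cases) auto
  have "heat s g x = (\<integral>w. indicator {0<..} w * (normal_density x (sqrt s) w * g w)
      + indicator {..<0} w * (normal_density x (sqrt s) w * g w) \<partial>lborel)"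
    unfolding heat_eq_lborel'[OF assms(2,1)]
    by (intro Bochner_Integration.integral_cong refl split)
  also have "\<dots> = (\<integral>w. indicator {0<..} w * (normal_density x (sqrt s) w * g w) \<partial>lborel)
      + (\<integral>w. indicator {..<0} w * (normal_density x (sqrt s) w * g w) \<partial>lborel)"
    by (intro Bochner_Integration.integral_add int) auto
  also have "(\<integral>w. indicator {..<0} w * (normal_density x (sqrt s) w * g w) \<partial>lborel) =
      (\<integral>w. indicator {..<0} (- w) * (normal_density x (sqrt s) (- w) * g (- w)) \<partial>lborel)"
    using lborel_integral_real_affine[of "- 1"
        "\<lambda>w. indicator {..<0} w * (normal_density x (sqrt s) w * g w)" 0] by simp
  also have "\<dots> = (\<integral>w. - (indicator {0<..} w * (normal_density (- x) (sqrt s) w * g w)) \<partial>lborel)"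
    by (intro Bochner_Integration.integral_cong)
      (auto simp: odd normal_density_def power2_eq_square algebra_simps split: split_indicator)
  also have "\<dots> = - (\<integral>w. indicator {0<..} w * (normal_density (- x) (sqrt s) w * g w) \<partial>lborel)"
    by simp
  finally show "heat s g x = (\<integral>w. indicator {0<..} w * (killed_density s x w * g w) \<partial>lborel)"
    unfolding eq by (subst Bochner_Integration.integral_diff) (auto intro!: int)
qed

subsection \<open>Brownian motion and its past\<close>

context brownian_motion
begin

definition past :: "real \<Rightarrow> 'a measure" where
  "past s = sigma (space M) {B r -` A \<inter> space M | r A. 0 \<le> r \<and> r \<le> s \<and> A \<in> sets borel}"

lemma space_past [simp]: "space (past s) = space M"
  by (auto simp: past_def intro!: space_measure_of)

lemma sets_past:
  "sets (past s) =
    sigma_sets (space M) {B r -` A \<inter> space M | r A. 0 \<le> r \<and> r \<le> s \<and> A \<in> sets borel}"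
  unfolding past_def by (auto intro!: sets_measure_of)

lemma measurable_past_B:
  assumes "0 \<le> r" "r \<le> s"
  shows "B r \<in> borel_measurable (past s)"
  using assms by (intro measurableI) (auto simp: sets_past intro!: sigma_sets.Basic)

lemma sets_past_subset: "sets (past s) \<subseteq> events"
  unfolding sets_past
  by (rule sets.sigma_sets_subset) (auto intro!: measurable_sets[OF random_variable])

lemma sets_past_mono: "s \<le> t \<Longrightarrow> sets (past s) \<subseteq> sets (past t)"
  unfolding sets_past by (rule sigma_sets_mono') fastforce

lemma measurable_past_imp_measurable: "f \<in> past s \<rightarrow>\<^sub>M N \<Longrightarrow> f \<in> M \<rightarrow>\<^sub>M N"
  using sets_past_subset[of s] by (auto simp: measurable_def)

lemma measurable_past_mono: "f \<in> past s \<rightarrow>\<^sub>M N \<Longrightarrow> s \<le> t \<Longrightarrow> f \<in> past t \<rightarrow>\<^sub>M N"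
  using sets_past_mono[of s t] by (auto simp: measurable_def)

text \<open>Finitely many past values are partial sums of increments over a common time grid, and
  independence of increments splits off the last one. Writing them as
  \<open>x + (B r \<omega> - B 0 \<omega>)\<close> makes the past event a function of increments
  alone, whatever the value at time 0 is.\<close>

lemma indep_finite_past:
  assumes "0 \<le> s" "s < t" and J: "finite J" "J \<subseteq> {0..s}"
    and Y: "Y \<in> sets (PiM J (\<lambda>_. borel))" and A: "A \<in> sets borel"
  defines "EY \<equiv> (\<lambda>\<omega>. \<lambda>r\<in>J. x + (B r \<omega> - B 0 \<omega>)) -` Y \<inter> space M"
    and "EA \<equiv> (\<lambda>\<omega>. B t \<omega> - B s \<omega>) -` A \<inter> space M"
  shows "prob (EY \<inter> EA) = prob EY * prob EA"
proof -
  \<comment> \<open>Time 0 is inserted so that the sums of increments telescope from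
    \<open>B 0\<close>, and \<open>s\<close> so that the last increment of the grid
    \<open>l @ [t]\<close> is exactly \<open>B t - B s\<close>.\<close>
  define l where "l = sorted_list_of_set (insert 0 (insert s J))"
  define m where "m = length l - 1"
  define tm where "tm i = (l @ [t]) ! i" for i
  have set_l: "set l = insert 0 (insert s J)"
    unfolding l_def using J by (subst set_sorted_list_of_set) auto
  have l_range: "set l \<subseteq> {0..s}"
    using J assms(1) by (auto simp: set_l)
  have "l \<noteq> []"
    using set_l by auto
  then have len: "length l = Suc m"
    by (cases l) (auto simp: m_def)
  have sorted_l: "sorted_wrt (<) l"
    unfolding l_def by (rule strict_sorted_list_of_set)
  then have sorted: "sorted_wrt (<) (l @ [t])"
    using l_range assms(2) by (auto simp: sorted_wrt_append)
  have tm_less: "tm i < tm j" if "i < j" "j \<le> Suc m" for i j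
    unfolding tm_def using sorted_wrt_nth_less[OF sorted that(1)] that(2) len by simp
  have tm_nth: "tm i = l ! i" if "i \<le> m" for i
    using that len by (simp add: tm_def nth_append)
  have in_l: "\<exists>i\<le>m. tm i = r" if "r \<in> set l" for r
    using that len tm_nth by (metis in_set_conv_nth less_Suc_eq_le)
  have tm_range: "0 \<le> tm i \<and> tm i \<le> s" if "i \<le> m" for i
    using subsetD[OF l_range nth_mem[of i l]] that len by (simp add: tm_nth)
  have tm_0: "tm 0 = 0"
  proof -
    obtain i where "i \<le> m" "tm i = 0"
      using in_l[of 0] set_l by auto
    then show ?thesis
      using tm_less[of 0 i] tm_range[of 0] by (cases "i = 0") auto
  qed
  have tm_m: "tm m = s"
  proof -
    obtain i where "i \<le> m" "tm i = s"
      using in_l[of s] set_l by auto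
    then show ?thesis
      using tm_less[of i m] tm_range[of m] by (cases "i = m") auto
  qed
  have tm_Suc_m: "tm (Suc m) = t"
    using len by (simp add: tm_def nth_append)
  have "\<forall>r\<in>J. \<exists>i\<le>m. tm i = r"
    using in_l set_l by auto
  then obtain idx where idx: "\<And>r. r \<in> J \<Longrightarrow> idx r \<le> m" "\<And>r. r \<in> J \<Longrightarrow> tm (idx r) = r"
    by metis
  define D where "D i \<omega> = B (tm (Suc i)) \<omega> - B (tm i) \<omega>" for i \<omega>
  have "indep_vars (\<lambda>_. borel) D {..<Suc m}"
    unfolding D_def using tm_less by (intro independent_increments) (auto simp: tm_0)
  then have indep: "indep_var (PiM {..<m} (\<lambda>_. borel)) (\<lambda>\<omega>. \<lambda>i\<in>{..<m}. D i \<omega>)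
      (PiM {m} (\<lambda>_. borel)) (\<lambda>\<omega>. \<lambda>i\<in>{m}. D i \<omega>)"
    by (rule indep_var_restrict) auto
  \<comment> \<open>\<open>\<phi>\<close> rebuilds the past values from the first \<open>m\<close>
    increments; increment number \<open>m\<close> is the future one.\<close>
  define \<phi> where "\<phi> v = (\<lambda>r\<in>J. x + (\<Sum>j<idx r. v j))" for v :: "nat \<Rightarrow> real"
  have "\<phi> \<in> PiM {..<m} (\<lambda>_. borel) \<rightarrow>\<^sub>M PiM J (\<lambda>_. borel)"
    unfolding \<phi>_def[abs_def] using idx(1)
    by (intro measurable_restrict borel_measurable_add borel_measurable_const borel_measurable_sum
        measurable_component_singleton) fastforce
  then have SY: "\<phi> -` Y \<inter> space (PiM {..<m} (\<lambda>_. borel)) \<in> sets (PiM {..<m} (\<lambda>_. borel))"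
    using Y by (rule measurable_sets)
  have SA: "(\<lambda>v. v m) -` A \<inter> space (PiM {m} (\<lambda>_. borel :: real measure)) \<in> sets (PiM {m} (\<lambda>_. borel))"
    using A by (intro measurable_sets[OF measurable_component_singleton]) auto
  have \<phi>_eq: "\<phi> (\<lambda>i\<in>{..<m}. D i \<omega>) = (\<lambda>r\<in>J. x + (B r \<omega> - B 0 \<omega>))" for \<omega>
    unfolding \<phi>_def
  proof (intro restrict_ext)
    fix r assume "r \<in> J"
    have "(\<Sum>j<idx r. (\<lambda>i\<in>{..<m}. D i \<omega>) j) = (\<Sum>j<idx r. B (tm (Suc j)) \<omega> - B (tm j) \<omega>)"
      using idx(1)[OF \<open>r \<in> J\<close>] by (intro sum.cong) (auto simp: D_def)
    also have "\<dots> = B r \<omega> - B 0 \<omega>"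
      by (subst sum_lessThan_telescope) (simp add: idx(2)[OF \<open>r \<in> J\<close>] tm_0)
    finally show "x + (\<Sum>j<idx r. (\<lambda>i\<in>{..<m}. D i \<omega>) j) = x + (B r \<omega> - B 0 \<omega>)"
      by simp
  qed
  have EY_eq: "EY = (\<lambda>\<omega>. \<lambda>i\<in>{..<m}. D i \<omega>) -`
      (\<phi> -` Y \<inter> space (PiM {..<m} (\<lambda>_. borel))) \<inter> space M"
    unfolding EY_def by (auto simp: \<phi>_eq space_PiM)
  have EA_eq: "EA = (\<lambda>\<omega>. \<lambda>i\<in>{m}. D i \<omega>) -`
      ((\<lambda>v. v m) -` A \<inter> space (PiM {m} (\<lambda>_. borel))) \<inter> space M"
    unfolding EA_def by (auto simp: D_def tm_m tm_Suc_m space_PiM)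
  have "EY \<inter> EA = (\<lambda>\<omega>. (\<lambda>i\<in>{..<m}. D i \<omega>, \<lambda>i\<in>{m}. D i \<omega>)) -`
      ((\<phi> -` Y \<inter> space (PiM {..<m} (\<lambda>_. borel))) \<times>
       ((\<lambda>v. v m) -` A \<inter> space (PiM {m} (\<lambda>_. borel)))) \<inter> space M"
    unfolding EY_eq EA_eq by blast
  then show ?thesis
    using indep_varD[OF indep SY SA] by (simp only: EY_eq EA_eq)
qed

section \<open>Visits to zero and measurability of the hitting time\<close>

definition hit_by :: "real \<Rightarrow> 'a set" where
  "hit_by t = {\<omega> \<in> space M. \<exists>r\<in>{0..t}. B r \<omega> = 0}"

lemma hit_by_mono: "s \<le> t \<Longrightarrow> hit_by s \<subseteq> hit_by t"
  by (auto simp: hit_by_def)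

text \<open>An uncountable union over times is reduced to countably many: on a compact interval a
  continuous path has a zero iff its absolute value becomes arbitrarily small at rational
  times.\<close>

lemma sets_past_hit_by:
  assumes "0 \<le> t"
  shows "hit_by t \<in> sets (past t)"
proof -
  \<comment> \<open>Rationals clamped to \<open>[0, t]\<close>. Clamping does not increase the
    distance to a zero in that interval, and it keeps the end point \<open>t\<close> reachable even
    if it is irrational.\<close>
  define q where "q c = min (max 0 (real_of_rat c)) t" for c
  have q: "0 \<le> q c" "q c \<le> t" for c
    using assms by (auto simp: q_def)
  have [measurable]: "B (q c) \<in> borel_measurable (past t)" for c
    using q by (rule measurable_past_B)
  have "hit_by t = {\<omega> \<in> space (past t). \<forall>m. \<exists>c. \<bar>B (q c) \<omega>\<bar> < inverse (real (Suc m))}"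
    (is "_ = ?H")
  proof (intro equalityI subsetI)
    fix \<omega> assume "\<omega> \<in> hit_by t"
    then obtain r where \<omega>: "\<omega> \<in> space M" and r: "0 \<le> r" "r \<le> t" "B r \<omega> = 0"
      by (auto simp: hit_by_def)
    have "\<exists>c. \<bar>B (q c) \<omega>\<bar> < inverse (real (Suc m))" for m
    proof -
      have "continuous_on {0..} (\<lambda>t. B t \<omega>)"
        using continuous_paths[OF \<omega>] .
      then obtain \<delta> where \<delta>: "\<delta> > 0"
        "\<And>r'. 0 \<le> r' \<Longrightarrow> \<bar>r' - r\<bar> < \<delta> \<Longrightarrow> \<bar>B r' \<omega> - B r \<omega>\<bar> < inverse (real (Suc m))"
        using r(1) unfolding continuous_on_iff dist_real_def
        by (metis atLeast_iff inverse_positive_iff_positive of_nat_0_less_iff zero_less_Suc)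
      obtain c where c: "r < real_of_rat c" "real_of_rat c < r + \<delta>"
        using of_rat_dense[of r "r + \<delta>"] \<delta>(1) by auto
      have "\<bar>q c - r\<bar> < \<delta>"
        using c r by (auto simp: q_def)
      then show ?thesis
        using \<delta>(2)[OF q(1)] r(3) by auto
    qed
    then show "\<omega> \<in> ?H"
      using \<omega> by simp
  next
    fix \<omega> assume "\<omega> \<in> ?H"
    then have \<omega>: "\<omega> \<in> space M" and small: "\<And>m. \<exists>c. \<bar>B (q c) \<omega>\<bar> < inverse (real (Suc m))"
      by auto
    \<comment> \<open>Conversely the minimum of the absolute value is attained on
      \<open>[0, t]\<close>; a positive minimum would contradict the small values at clamped
      rationals.\<close>
    have "continuous_on {0..t} (\<lambda>r. \<bar>B r \<omega>\<bar>)"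
      by (intro continuous_intros continuous_on_subset[OF continuous_paths[OF \<omega>]]) auto
    then obtain r where r: "r \<in> {0..t}" and min: "\<And>r'. r' \<in> {0..t} \<Longrightarrow> \<bar>B r \<omega>\<bar> \<le> \<bar>B r' \<omega>\<bar>"
      using continuous_attains_inf[of "{0..t}" "\<lambda>r. \<bar>B r \<omega>\<bar>"] assms by auto
    have "B r \<omega> = 0"
    proof (rule ccontr)
      assume "B r \<omega> \<noteq> 0"
      then obtain m where "inverse (real (Suc m)) < \<bar>B r \<omega>\<bar>"
        using reals_Archimedean[of "\<bar>B r \<omega>\<bar>"] by auto
      moreover obtain c where "\<bar>B (q c) \<omega>\<bar> < inverse (real (Suc m))"
        using small by blast
      ultimately show False
        using min[of "q c"] q[of c] by auto
    qed
    then show "\<omega> \<in> hit_by t"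
      using r \<omega> by (auto simp: hit_by_def)
  qed
  also have "\<dots> \<in> sets (past t)"
    by measurable
  finally show ?thesis .
qed

lemma events_hit_by: "0 \<le> t \<Longrightarrow> hit_by t \<in> events"
  using sets_past_hit_by sets_past_subset by blast

lemma first_zero_attained:
  assumes \<omega>: "\<omega> \<in> space M" and r: "0 \<le> r" "B r \<omega> = 0"
  defines "\<tau> \<equiv> real_of_ereal (hitting_time B 0 \<omega>)"
  shows "0 \<le> \<tau>" "B \<tau> \<omega> = 0" "\<And>r. 0 \<le> r \<Longrightarrow> B r \<omega> = 0 \<Longrightarrow> \<tau> \<le> r"
proof -
  define S where "S = {t. 0 \<le> t \<and> B t \<omega> = 0}"
  have S: "S \<noteq> {}" "bdd_below S"
    using r by (auto simp: S_def intro!: bdd_belowI[of _ 0])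
  have "hitting_time B 0 \<omega> = ereal (Inf S)"
    unfolding hitting_time_def S_def[symmetric] using S by (simp add: ereal_Inf')
  then have \<tau>: "\<tau> = Inf S"
    by (simp add: \<tau>_def)
  have "S = {0..} \<inter> (\<lambda>t. B t \<omega>) -` {0}"
    by (auto simp: S_def)
  then have "closed S"
    using continuous_closed_preimage[OF continuous_paths[OF \<omega>], of "{0}"] by simp
  then have "Inf S \<in> S"
    using S by (intro closed_contains_Inf)
  then show "0 \<le> \<tau>" "B \<tau> \<omega> = 0"
    by (auto simp: \<tau> S_def)
  show "\<tau> \<le> r" if "0 \<le> r" "B r \<omega> = 0" for r
    unfolding \<tau> using S that by (intro cInf_lower) (auto simp: S_def)
qed

lemma hitting_time_eq_0_if_no_zero:
  assumes "\<And>r. 0 \<le> r \<Longrightarrow> B r \<omega> \<noteq> 0"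
  shows "real_of_ereal (hitting_time B 0 \<omega>) = 0"
proof -
  have "{t. 0 \<le> t \<and> B t \<omega> = 0} = {}"
    using assms by auto
  then show ?thesis
    unfolding hitting_time_def by (simp add: top_ereal_def del: Collect_empty_eq)
qed

lemma hitting_time_nonneg:
  assumes "\<omega> \<in> space M"
  shows "0 \<le> real_of_ereal (hitting_time B 0 \<omega>)"
proof (cases "\<exists>r\<ge>0. B r \<omega> = 0")
  case True
  then show ?thesis
    using first_zero_attained(1)[OF assms] by blast
next
  case False
  then show ?thesis
    using hitting_time_eq_0_if_no_zero[of \<omega>] by auto
qed

text \<open>The second alternative is the default value at work: a path without any zero has hitting
  time \<infinity>, which \<open>real_of_ereal\<close> turns into 0, below every
  \<open>t \<ge> 0\<close>.\<close>

lemma hitting_time_le_iff: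
  assumes \<omega>: "\<omega> \<in> space M" and "0 \<le> t"
  shows "real_of_ereal (hitting_time B 0 \<omega>) \<le> t \<longleftrightarrow>
    \<omega> \<in> hit_by t \<or> (\<forall>n. \<omega> \<notin> hit_by (real n))"
proof (cases "\<exists>r\<ge>0. B r \<omega> = 0")
  case True
  then obtain r where r: "0 \<le> r" "B r \<omega> = 0" by auto
  obtain n where "r \<le> real n"
    using real_arch_simple by blast
  then have "\<omega> \<in> hit_by (real n)"
    using r \<omega> by (auto simp: hit_by_def)
  moreover have "real_of_ereal (hitting_time B 0 \<omega>) \<le> t \<longleftrightarrow> \<omega> \<in> hit_by t"
  proof
    assume "real_of_ereal (hitting_time B 0 \<omega>) \<le> t"
    then show "\<omega> \<in> hit_by t"
      using first_zero_attained(1,2)[OF \<omega> r] \<omega> unfolding hit_by_def by auto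
  next
    assume "\<omega> \<in> hit_by t"
    then obtain r' where "0 \<le> r'" "r' \<le> t" "B r' \<omega> = 0"
      by (auto simp: hit_by_def)
    then show "real_of_ereal (hitting_time B 0 \<omega>) \<le> t"
      using first_zero_attained(3)[OF \<omega> r, of r'] by linarith
  qed
  ultimately show ?thesis
    by blast
next
  case False
  then have "real_of_ereal (hitting_time B 0 \<omega>) = 0"
    by (intro hitting_time_eq_0_if_no_zero) auto
  then show ?thesis
    using False assms by (auto simp: hit_by_def)
qed

lemma borel_measurable_hitting_time [measurable]:
  "(\<lambda>\<omega>. real_of_ereal (hitting_time B 0 \<omega>)) \<in> borel_measurable M"
proof (rule borel_measurable_iff_le[THEN iffD2], rule allI)
  fix a :: real
  show "{\<omega> \<in> space M. real_of_ereal (hitting_time B 0 \<omega>) \<le> a} \<in> events"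
  proof (cases "0 \<le> a")
    case True
    then have "{\<omega> \<in> space M. real_of_ereal (hitting_time B 0 \<omega>) \<le> a} =
        hit_by a \<union> (space M - (\<Union>n. hit_by (real n)))"
      using sets.sets_into_space[OF events_hit_by[of a]] hitting_time_le_iff[of _ a] by blast
    then show ?thesis
      using True by (auto intro!: sets.Un sets.Diff sets.countable_UN events_hit_by)
  next
    case False
    then have "{\<omega> \<in> space M. real_of_ereal (hitting_time B 0 \<omega>) \<le> a} = {}"
      using hitting_time_nonneg by force
    then show ?thesis by (simp only: sets.empty_sets)
  qed
qed

text \<open>Rounding \<open>S\<close> down to a grid leaves countably many deterministic times,
  where measurability is known, and continuity of the paths carries it to the limit.\<close>

lemma measurable_random_time:
  assumes [measurable]: "S \<in> borel_measurable M" and S: "\<And>\<omega>. \<omega> \<in> space M \<Longrightarrow> 0 \<le> S \<omega>"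
  shows "(\<lambda>\<omega>. B (S \<omega>) \<omega>) \<in> borel_measurable M"
proof -
  define k where "k n \<omega> = nat \<lfloor>real (Suc n) * S \<omega>\<rfloor>" for n \<omega>
  show ?thesis
  proof (rule borel_measurable_LIMSEQ_real[where u="\<lambda>n \<omega>. B (real (k n \<omega>) / real (Suc n)) \<omega>"])
    fix n
    have "(\<lambda>\<omega>. (\<lambda>k \<omega>. B (real k / real (Suc n)) \<omega>) (k n \<omega>) \<omega>) \<in> borel_measurable M"
    proof (rule measurable_compose_countable[where g="k n"])
      show "k n \<in> M \<rightarrow>\<^sub>M count_space UNIV"
        unfolding k_def by measurable
    qed (intro random_variable, simp)
    then show "(\<lambda>\<omega>. B (real (k n \<omega>) / real (Suc n)) \<omega>) \<in> borel_measurable M"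
      by simp
  next
    fix \<omega> assume \<omega>: "\<omega> \<in> space M"
    have k: "real (k n \<omega>) = of_int \<lfloor>real (Suc n) * S \<omega>\<rfloor>" for n
      unfolding k_def using S[OF \<omega>] by simp
    have "(\<lambda>n. real (k n \<omega>) / real (Suc n)) \<longlonglongrightarrow> S \<omega>"
    proof (rule tendsto_sandwich)
      have "S \<omega> - 1 / real (Suc n) \<le> real (k n \<omega>) / real (Suc n) \<and>
          real (k n \<omega>) / real (Suc n) \<le> S \<omega>" for n
      proof -
        define N where "N = real (Suc n)"
        have N: "0 < N" by (simp add: N_def)
        have le: "N * S \<omega> - 1 \<le> real (k n \<omega>)" "real (k n \<omega>) \<le> N * S \<omega>"
          unfolding k N_def using floor_correct[of "real (Suc n) * S \<omega>"] by linarith+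
        have "S \<omega> - 1 / N = (N * S \<omega> - 1) / N"
          using N by (simp add: field_simps)
        also have "\<dots> \<le> real (k n \<omega>) / N"
          using le(1) N by (intro divide_right_mono) auto
        finally show ?thesis
          unfolding N_def[symmetric] using le(2) N by (simp add: divide_le_eq mult.commute)
      qed
      then show "\<forall>\<^sub>F n in sequentially. S \<omega> - 1 / real (Suc n) \<le> real (k n \<omega>) / real (Suc n)"
        "\<forall>\<^sub>F n in sequentially. real (k n \<omega>) / real (Suc n) \<le> S \<omega>"
        by auto
      show "(\<lambda>n. S \<omega> - 1 / real (Suc n)) \<longlonglongrightarrow> S \<omega>"
        by real_asymp
    qed simp
    then show "(\<lambda>n. B (real (k n \<omega>) / real (Suc n)) \<omega>) \<longlonglongrightarrow> B (S \<omega>) \<omega>"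
      using S[OF \<omega>] by (intro continuous_on_tendsto_compose[OF continuous_paths[OF \<omega>]]) auto
  qed
qed

lemma measurable_value_at_fraction:
  assumes "0 \<le> u"
  shows "value_at_fraction_of_hitting_time B u \<in> borel_measurable M"
  unfolding value_at_fraction_of_hitting_time_def[abs_def]
  using assms hitting_time_nonneg by (intro measurable_random_time) auto

end

text \<open>With the start fixed on every path, \<open>B r\<close> and
  \<open>x + (B r - B 0)\<close> are the same function, so the events of \<open>past s\<close> are
  literally events about increments and no null sets enter the independence argument.\<close>

locale pinned_brownian_motion = brownian_motion +
  assumes pinned: "\<And>\<omega>. \<omega> \<in> space M \<Longrightarrow> B 0 \<omega> = x"
begin

text \<open>Cylinder events over finite time sets are independent of the increment and closed under
  intersection, so independence extends to the generated sigma-algebras.\<close>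

lemma indep_past:
  assumes "0 \<le> s" "s < t"
  shows "indep_set (sets (past s))
    (sigma_sets (space M) {(\<lambda>\<omega>. B t \<omega> - B s \<omega>) -` A \<inter> space M | A. A \<in> sets borel})"
proof -
  define V where "V J \<omega> = (\<lambda>r\<in>J. B r \<omega>)" for J \<omega>
  define G where "G = {V J -` Y \<inter> space M | J Y.
    finite J \<and> J \<subseteq> {0..s} \<and> Y \<in> sets (PiM J (\<lambda>_. borel))}"
  define I where "I = {(\<lambda>\<omega>. B t \<omega> - B s \<omega>) -` A \<inter> space M | A. A \<in> sets borel}"
  have V_rv: "V J \<in> M \<rightarrow>\<^sub>M PiM J (\<lambda>_. borel)" if "J \<subseteq> {0..s}" for J
    unfolding V_def using that by (intro measurable_restrict random_variable) auto
  have I_rv: "(\<lambda>\<omega>. B t \<omega> - B s \<omega>) \<in> borel_measurable M"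
    using assms by (intro borel_measurable_diff random_variable) auto
  have GI: "indep_set G I"
    unfolding indep_sets2_eq
  proof (intro conjI ballI)
    show "G \<subseteq> events" "I \<subseteq> events"
      unfolding G_def I_def using V_rv I_rv by (auto intro: measurable_sets)
    fix a b assume "a \<in> G" "b \<in> I"
    then obtain J Y A where J: "finite J" "J \<subseteq> {0..s}" and Y: "Y \<in> sets (PiM J (\<lambda>_. borel))"
      and a: "a = V J -` Y \<inter> space M" and A: "A \<in> sets borel"
      and b: "b = (\<lambda>\<omega>. B t \<omega> - B s \<omega>) -` A \<inter> space M"
      unfolding G_def I_def by blast
    have a': "a = (\<lambda>\<omega>. \<lambda>r\<in>J. x + (B r \<omega> - B 0 \<omega>)) -` Y \<inter> space M"
      unfolding a V_def by (auto simp: pinned)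
    show "prob (a \<inter> b) = prob a * prob b"
      unfolding a' b by (rule indep_finite_past[OF assms J Y A])
  qed
  have "Int_stable G"
  proof (rule Int_stableI)
    fix a b assume "a \<in> G" "b \<in> G"
    then obtain J Y J' Y' where J: "finite J" "J \<subseteq> {0..s}" "Y \<in> sets (PiM J (\<lambda>_. borel))"
        "a = V J -` Y \<inter> space M" and J': "finite J'" "J' \<subseteq> {0..s}"
        "Y' \<in> sets (PiM J' (\<lambda>_. borel))" "b = V J' -` Y' \<inter> space M"
      unfolding G_def by blast
    \<comment> \<open>Two cylinders over different time sets become cylinders over the union of
      these sets, where they can be intersected.\<close>
    define K where "K = J \<union> J'"
    define W where "W = ((\<lambda>v. restrict v J) -` Y \<inter> space (PiM K (\<lambda>_. borel))) \<inter>
      ((\<lambda>v. restrict v J') -` Y' \<inter> space (PiM K (\<lambda>_. borel :: real measure)))"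
    have "W \<in> sets (PiM K (\<lambda>_. borel))"
      unfolding W_def using J(3) J'(3)
      by (intro sets.Int measurable_sets[OF measurable_restrict_subset]) (auto simp: K_def)
    moreover have "restrict (V K \<omega>) J = V J \<omega>" "restrict (V K \<omega>) J' = V J' \<omega>" for \<omega>
      by (auto simp: V_def K_def fun_eq_iff)
    then have "a \<inter> b = V K -` W \<inter> space M"
      unfolding J(4) J'(4) W_def by (auto simp: space_PiM V_def)
    moreover have "finite K" "K \<subseteq> {0..s}"
      using J(1,2) J'(1,2) unfolding K_def by blast+
    ultimately show "a \<inter> b \<in> G"
      unfolding G_def by blast
  qed
  moreover have "Int_stable I"
  proof (rule Int_stableI)
    fix a b assume "a \<in> I" "b \<in> I"
    then obtain A A' where "A \<in> sets borel" "A' \<in> sets borel"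
      "a = (\<lambda>\<omega>. B t \<omega> - B s \<omega>) -` A \<inter> space M" "b = (\<lambda>\<omega>. B t \<omega> - B s \<omega>) -` A' \<inter> space M"
      unfolding I_def by blast
    then show "a \<inter> b \<in> I"
      unfolding I_def by (auto intro!: exI[of _ "A \<inter> A'"])
  qed
  ultimately have indep: "indep_set (sigma_sets (space M) G) (sigma_sets (space M) I)"
    using GI by (intro indep_set_sigma_sets)
  have "sets (past s) \<subseteq> sigma_sets (space M) G"
    unfolding sets_past
  proof (rule sigma_sets_mono, safe)
    fix r and A :: "real set" assume r: "0 \<le> r" "r \<le> s" and A: "A \<in> sets borel"
    define Y where "Y = (\<lambda>v. v r) -` A \<inter> space (PiM {r} (\<lambda>_. borel :: real measure))"
    have "Y \<in> sets (PiM {r} (\<lambda>_. borel))"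
      unfolding Y_def using A by (intro measurable_sets[OF measurable_component_singleton]) auto
    moreover have "B r -` A \<inter> space M = V {r} -` Y \<inter> space M"
      by (auto simp: Y_def V_def space_PiM)
    ultimately have "B r -` A \<inter> space M \<in> G"
      unfolding G_def using r by (intro CollectI exI[of _ "{r}"] exI[of _ Y]) auto
    then show "B r -` A \<inter> space M \<in> sigma_sets (space M) G"
      by (rule sigma_sets.Basic)
  qed
  then show ?thesis
    using indep unfolding indep_set_def I_def
    by (elim indep_sets_mono_sets) (auto split: bool.split)
qed

text \<open>The simple Markov property in integrated form: \<open>B t\<close> is \<open>B s\<close>
  plus a Gaussian increment independent of \<open>past s\<close>, and Fubini averages over that
  increment. The weight \<open>Z\<close> is what allows conditioning on earlier hits.\<close>

lemma expectation_markov: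
  assumes "0 \<le> s" "s \<le> t"
    and Z: "Z \<in> borel_measurable (past s)" "\<And>\<omega>. \<omega> \<in> space M \<Longrightarrow> \<bar>Z \<omega>\<bar> \<le> K"
    and g [measurable]: "g \<in> borel_measurable borel" and gC: "\<And>y. \<bar>g y\<bar> \<le> C"
  shows "expectation (\<lambda>\<omega>. Z \<omega> * g (B t \<omega>)) = expectation (\<lambda>\<omega>. Z \<omega> * heat (t - s) g (B s \<omega>))"
proof (cases "s = t")
  case False
  with assms(2) have "s < t" by simp
  define X where "X \<omega> = (Z \<omega>, B s \<omega>)" for \<omega>
  \<comment> \<open>The dummy component 0 gives \<open>Y\<close> the same type as \<open>X\<close>,
    as \<open>indep_var\<close> demands.\<close>
  define Y where "Y \<omega> = (0 :: real, B t \<omega> - B s \<omega>)" for \<omega>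
  \<comment> \<open>\<open>Z\<close> is bounded by \<open>K\<close> only on \<open>space M\<close>;
    clamping the first component makes \<open>h\<close> bounded, hence integrable, on the whole
    product space and changes nothing along \<open>X\<close>.\<close>
  define h :: "(real \<times> real) \<times> (real \<times> real) \<Rightarrow> real" where
    "h = (\<lambda>(p, q). max (- K) (min K (fst p)) * g (snd p + snd q))"
  have [measurable]: "h \<in> borel_measurable ((borel \<Otimes>\<^sub>M borel) \<Otimes>\<^sub>M (borel \<Otimes>\<^sub>M borel))"
    unfolding h_def by measurable
  have X_past: "X \<in> past s \<rightarrow>\<^sub>M borel \<Otimes>\<^sub>M borel"
    unfolding X_def using Z(1) measurable_past_B[of s s] assms(1) by (intro measurable_Pair) auto
  then have X [measurable]: "X \<in> M \<rightarrow>\<^sub>M borel \<Otimes>\<^sub>M borel"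
    by (rule measurable_past_imp_measurable)
  have inc [measurable]: "(\<lambda>\<omega>. B t \<omega> - B s \<omega>) \<in> borel_measurable M"
    using assms by (intro borel_measurable_diff random_variable) auto
  have Y [measurable]: "Y \<in> M \<rightarrow>\<^sub>M borel \<Otimes>\<^sub>M borel"
    unfolding Y_def by measurable
  have "indep_var (borel \<Otimes>\<^sub>M borel) X (borel \<Otimes>\<^sub>M borel) Y"
    unfolding indep_var_eq
  proof (intro conjI X Y)
    have "sigma_sets (space M) {X -` A \<inter> space M |A. A \<in> sets (borel \<Otimes>\<^sub>M borel)} \<subseteq> sets (past s)"
      using measurable_sets[OF X_past]
      by (subst space_past[of s, symmetric], intro sets.sigma_sets_subset) auto
    moreover have "sigma_sets (space M) {Y -` A \<inter> space M |A. A \<in> sets (borel \<Otimes>\<^sub>M borel)} \<subseteq>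
      sigma_sets (space M) {(\<lambda>\<omega>. B t \<omega> - B s \<omega>) -` A \<inter> space M |A. A \<in> sets borel}"
    proof (rule sigma_sets_mono', safe)
      fix A :: "(real \<times> real) set" assume A: "A \<in> sets (borel \<Otimes>\<^sub>M borel)"
      have "Pair 0 -` A \<in> sets borel"
        using A by (rule sets_Pair1)
      moreover have "Y -` A \<inter> space M = (\<lambda>\<omega>. B t \<omega> - B s \<omega>) -` (Pair 0 -` A) \<inter> space M"
        by (auto simp: Y_def)
      ultimately show "\<exists>A'. Y -` A \<inter> space M = (\<lambda>\<omega>. B t \<omega> - B s \<omega>) -` A' \<inter> space M \<and> A' \<in> sets borel"
        by blast
    qed
    ultimately show "indep_set (sigma_sets (space M) {X -` A \<inter> space M |A. A \<in> sets (borel \<Otimes>\<^sub>M borel)})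
        (sigma_sets (space M) {Y -` A \<inter> space M |A. A \<in> sets (borel \<Otimes>\<^sub>M borel)})"
      using indep_past[OF assms(1) \<open>s < t\<close>] unfolding indep_set_def
      by (elim indep_sets_mono_sets) (auto split: bool.split)
  qed
  then have joint: "distr M ((borel \<Otimes>\<^sub>M borel) \<Otimes>\<^sub>M (borel \<Otimes>\<^sub>M borel)) (\<lambda>\<omega>. (X \<omega>, Y \<omega>)) =
      distr M (borel \<Otimes>\<^sub>M borel) X \<Otimes>\<^sub>M distr M (borel \<Otimes>\<^sub>M borel) Y"
    by (simp add: indep_var_distribution_eq)
  interpret PX: prob_space "distr M (borel \<Otimes>\<^sub>M borel) X"
    by (rule prob_space_distr) measurable
  interpret PY: prob_space "distr M (borel \<Otimes>\<^sub>M borel) Y"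
    by (rule prob_space_distr) measurable
  interpret XY: pair_prob_space "distr M (borel \<Otimes>\<^sub>M borel) X" "distr M (borel \<Otimes>\<^sub>M borel) Y" ..
  have "0 \<le> C"
    using gC[of 0] by linarith
  obtain \<omega>0 where "\<omega>0 \<in> space M"
    using not_empty by auto
  then have "0 \<le> K"
    using Z(2)[of \<omega>0] by linarith
  have clamp: "\<bar>max (- K) (min K z)\<bar> \<le> K" for z
    using \<open>0 \<le> K\<close> by auto
  have h_int: "integrable (distr M (borel \<Otimes>\<^sub>M borel) X \<Otimes>\<^sub>M distr M (borel \<Otimes>\<^sub>M borel) Y) h"
    using \<open>0 \<le> K\<close> by (intro XY.P.integrable_const_bound[of _ "K * C"])
      (auto simp: h_def abs_mult intro!: mult_mono clamp gC AE_I2)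
  have inc_distr: "distr M borel (\<lambda>\<omega>. B t \<omega> - B s \<omega>) = density lborel (\<lambda>w. ennreal (normal_density 0 (sqrt (t - s)) w))"
    using distributed_distr_eq_density[OF normal_increments[OF assms(1) \<open>s < t\<close>]]
    by (simp cong: distr_cong)
  have inner: "(\<integral>w. h (p, w) \<partial>distr M (borel \<Otimes>\<^sub>M borel) Y) = max (- K) (min K (fst p)) * heat (t - s) g (snd p)" for p
  proof -
    have "(\<integral>w. h (p, w) \<partial>distr M (borel \<Otimes>\<^sub>M borel) Y) = expectation (\<lambda>\<omega>. h (p, Y \<omega>))"
      by (subst integral_distr) (auto simp: h_def)
    also have "\<dots> = (\<integral>w. h (p, (0, w)) \<partial>distr M borel (\<lambda>\<omega>. B t \<omega> - B s \<omega>))"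
      by (subst integral_distr) (auto simp: h_def Y_def)
    also have "\<dots> = (\<integral>w. max (- K) (min K (fst p)) * (normal_density 0 (sqrt (t - s)) w * g (snd p + w)) \<partial>lborel)"
      unfolding inc_distr by (subst integral_density) (auto simp: h_def split_beta mult_ac)
    finally show ?thesis
      using \<open>s < t\<close> by (simp add: heat_eq_lborel)
  qed
  have clamp_Z: "max (- K) (min K (Z \<omega>)) = Z \<omega>" if "\<omega> \<in> space M" for \<omega>
    using Z(2)[OF that] by auto
  have "expectation (\<lambda>\<omega>. Z \<omega> * g (B t \<omega>)) = expectation (\<lambda>\<omega>. h (X \<omega>, Y \<omega>))"
    by (intro Bochner_Integration.integral_cong) (auto simp: h_def X_def Y_def clamp_Z)
  also have "\<dots> = (\<integral>p. h p \<partial>(distr M (borel \<Otimes>\<^sub>M borel) X \<Otimes>\<^sub>M distr M (borel \<Otimes>\<^sub>M borel) Y))"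
    unfolding joint[symmetric] by (subst integral_distr) auto
  also have "\<dots> = (\<integral>p. \<integral>w. h (p, w) \<partial>distr M (borel \<Otimes>\<^sub>M borel) Y \<partial>distr M (borel \<Otimes>\<^sub>M borel) X)"
    using h_int by (rule XY.integral_fst'[symmetric])
  also have "\<dots> = (\<integral>p. max (- K) (min K (fst p)) * heat (t - s) g (snd p) \<partial>distr M (borel \<Otimes>\<^sub>M borel) X)"
    unfolding inner ..
  also have "\<dots> = expectation (\<lambda>\<omega>. max (- K) (min K (fst (X \<omega>))) * heat (t - s) g (snd (X \<omega>)))"
    by (subst integral_distr) auto
  also have "\<dots> = expectation (\<lambda>\<omega>. Z \<omega> * heat (t - s) g (B s \<omega>))"
    by (intro Bochner_Integration.integral_cong) (auto simp: X_def clamp_Z)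
  finally show ?thesis .
qed simp

subsection \<open>The reflection principle\<close>

text \<open>
  The time of the first zero in \<open>(s, t]\<close> is rounded up to a grid. The Markov property at the rounded
  time leaves an odd Lipschitz function of a value of \<open>B\<close> close to \<open>0\<close>.
\<close>

lemma expectation_reflection:
  fixes Z :: "'a \<Rightarrow> real"
  assumes "0 \<le> s" "s \<le> t"
    and Z: "Z \<in> borel_measurable (past s)" "\<And>\<omega>. \<omega> \<in> space M \<Longrightarrow> \<bar>Z \<omega>\<bar> \<le> K"
    and g: "L-lipschitz_on UNIV g" "\<And>y. g (- y) = - g y" "\<And>y. \<bar>g y\<bar> \<le> C"
  shows "expectation (\<lambda>\<omega>. Z \<omega> * (indicator (hit_by t - hit_by s) \<omega> * g (B t \<omega>))) = 0"
proof -
  have [measurable]: "g \<in> borel_measurable borel"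
    using g(1) by (intro borel_measurable_continuous_onI lipschitz_on_continuous_on)
  have [measurable]: "Z \<in> borel_measurable M"
    using Z(1) by (rule measurable_past_imp_measurable)
  have L: "0 \<le> L"
    using g(1) by (rule lipschitz_on_nonneg)
  have C: "0 \<le> C"
    using g(3)[of 0] by linarith
  define d where "d n = (t - s) / real (Suc n)" for n
  define tm where "tm n k = s + d n * real k" for n k
  define I where "I n k \<omega> = (indicator (hit_by (tm n (Suc k)) - hit_by (tm n k)) \<omega> :: real)" for n k \<omega>
  define R where "R n \<omega> = (\<Sum>k<Suc n. I n k \<omega> *
    heat (t - tm n (Suc k)) g (B (tm n (Suc k)) \<omega>))" for n \<omega>
  have d: "0 \<le> d n" for n
    using assms by (simp add: d_def)
  have tm_0: "tm n 0 = s" and tm_last: "tm n (Suc n) = t" for n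
    using assms by (simp_all add: tm_def d_def)
  have tm_mono: "tm n k \<le> tm n k'" if "k \<le> k'" for n k k'
    using that d by (simp add: tm_def mult_left_mono)
  have tm_Suc: "tm n (Suc k) = tm n k + d n" for n k
    by (simp add: tm_def algebra_simps)
  have tm_range: "s \<le> tm n k" "0 \<le> tm n k" for n k
    using tm_mono[of 0 k n] assms by (auto simp: tm_0)
  have tm_le: "tm n k \<le> t" if "k \<le> Suc n" for n k
    using tm_mono[OF that, of n] by (simp add: tm_last)
  have I_diff: "I n k \<omega> = indicator (hit_by (tm n (Suc k))) \<omega> - indicator (hit_by (tm n k)) \<omega>" for n k \<omega>
    using hit_by_mono[OF tm_mono[of k "Suc k" n]] by (auto simp: I_def split: split_indicator)
  have I_sum: "(\<Sum>k<Suc n. I n k \<omega>) = indicator (hit_by t - hit_by s) \<omega>" for n \<omega>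
  proof -
    have "(\<Sum>k<Suc n. I n k \<omega>) = indicator (hit_by t) \<omega> - indicator (hit_by s) \<omega>"
      unfolding I_diff
      using sum_lessThan_telescope[of "\<lambda>k. indicator (hit_by (tm n k)) \<omega> :: real" "Suc n"]
      unfolding tm_0 tm_last .
    then show ?thesis
      using hit_by_mono[OF assms(2)] by (auto split: split_indicator)
  qed
  have I_nonneg: "0 \<le> I n k \<omega>" and I_le: "I n k \<omega> \<le> 1" for n k \<omega>
    by (auto simp: I_def split: split_indicator)
  have I_past: "I n k \<in> borel_measurable (past (tm n (Suc k)))" for n k
    unfolding I_def[abs_def]
    using tm_range[of n k] tm_range[of n "Suc k"] tm_mono[of k "Suc k" n]
    by (intro borel_measurable_indicator sets.Diff sets_past_hit_by
        subsetD[OF sets_past_mono sets_past_hit_by]) auto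
  have [measurable]: "I n k \<in> borel_measurable M" for n k
    using I_past by (rule measurable_past_imp_measurable)
  have [measurable]: "B (tm n k) \<in> borel_measurable M" "B t \<in> borel_measurable M" for n k
    using tm_range assms by (auto intro!: random_variable)
  have [measurable]: "R n \<in> borel_measurable M" for n
    unfolding R_def by measurable
  have sum_bound: "\<bar>R n \<omega>\<bar> \<le> c"
    if c: "0 \<le> c" "\<And>k. k < Suc n \<Longrightarrow> I n k \<omega> \<noteq> 0 \<Longrightarrow>
      \<bar>heat (t - tm n (Suc k)) g (B (tm n (Suc k)) \<omega>)\<bar> \<le> c" for c n \<omega>
  proof -
    have "\<bar>R n \<omega>\<bar> \<le> (\<Sum>k<Suc n. \<bar>I n k \<omega> * heat (t - tm n (Suc k)) g (B (tm n (Suc k)) \<omega>)\<bar>)"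
      unfolding R_def by (rule sum_abs)
    also have "\<dots> \<le> (\<Sum>k<Suc n. I n k \<omega> * c)"
    proof (rule sum_mono)
      fix k assume "k \<in> {..<Suc n}"
      then show "\<bar>I n k \<omega> * heat (t - tm n (Suc k)) g (B (tm n (Suc k)) \<omega>)\<bar> \<le> I n k \<omega> * c"
        using c(2)[of k] I_nonneg[of n k \<omega>]
        by (cases "I n k \<omega> = 0") (auto simp: abs_mult intro!: mult_left_mono)
    qed
    also have "\<dots> = indicator (hit_by t - hit_by s) \<omega> * c"
      unfolding sum_distrib_right[symmetric] I_sum ..
    also have "\<dots> \<le> c"
      using c(1) by (auto split: split_indicator)
    finally show ?thesis .
  qed
  have R_bound: "\<bar>R n \<omega>\<bar> \<le> C" for n \<omega>
    using C g(3) by (intro sum_bound abs_heat_le) auto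
  have R_lim: "(\<lambda>n. R n \<omega>) \<longlonglongrightarrow> 0" if \<omega>: "\<omega> \<in> space M" for \<omega>
  proof (rule LIMSEQ_I)
    fix e :: real assume "0 < e"
    \<comment> \<open>\<open>L + 1\<close> in place of \<open>L\<close> avoids a division by zero
      when \<open>g\<close> is constant.\<close>
    define e' where "e' = e / (2 * (L + 1))"
    have e': "0 < e'" "L * e' < e"
    proof -
      show "0 < e'"
        using \<open>0 < e\<close> L by (simp add: e'_def)
      then have "L * e' < (L + 1) * e'"
        by simp
      also have "\<dots> = e / 2"
        using L by (simp add: e'_def field_simps)
      finally show "L * e' < e"
        using \<open>0 < e\<close> by simp
    qed
    have "uniformly_continuous_on {0..t} (\<lambda>r. B r \<omega>)"
      by (intro compact_uniformly_continuous continuous_on_subset[OF continuous_paths[OF \<omega>]]) auto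
    then obtain \<delta> where \<delta>: "0 < \<delta>" "\<And>r r'. r \<in> {0..t} \<Longrightarrow> r' \<in> {0..t} \<Longrightarrow> \<bar>r' - r\<bar> < \<delta> \<Longrightarrow>
        \<bar>B r' \<omega> - B r \<omega>\<bar> < e'"
      unfolding uniformly_continuous_on_def dist_real_def using e'(1) by metis
    have "d \<longlonglongrightarrow> 0"
      unfolding d_def[abs_def] by real_asymp
    then obtain N where N: "\<And>n. N \<le> n \<Longrightarrow> d n < \<delta>"
      using order_tendstoD(2)[OF \<open>d \<longlonglongrightarrow> 0\<close> \<delta>(1)] by (auto simp: eventually_sequentially)
    have "\<bar>R n \<omega>\<bar> < e" if "N \<le> n" for n
    proof -
      have "\<bar>R n \<omega>\<bar> \<le> L * e'"
      proof (rule sum_bound)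
        show "0 \<le> L * e'"
          using L e'(1) by simp
        fix k assume k: "k < Suc n" "I n k \<omega> \<noteq> 0"
        then have "\<omega> \<in> hit_by (tm n (Suc k))" "\<omega> \<notin> hit_by (tm n k)"
          by (auto simp: I_def split: split_indicator_asm)
        then obtain r where r: "0 \<le> r" "r \<le> tm n (Suc k)" "B r \<omega> = 0" "tm n k < r"
          using \<omega> by (force simp: hit_by_def)
        have "\<bar>tm n (Suc k) - r\<bar> < \<delta>"
          using r N[OF that] by (simp add: tm_Suc)
        then have "\<bar>B (tm n (Suc k)) \<omega> - B r \<omega>\<bar> < e'"
          using r tm_le[of "Suc k" n] k(1) tm_range[of n "Suc k"] by (intro \<delta>(2)) auto
        moreover have "heat (t - tm n (Suc k)) g 0 = 0"
          using heat_uminus[of g, OF _ g(2), of "t - tm n (Suc k)" 0] by simp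
        then have "\<bar>heat (t - tm n (Suc k)) g (B (tm n (Suc k)) \<omega>)\<bar> \<le> L * \<bar>B (tm n (Suc k)) \<omega>\<bar>"
          using lipschitz_onD[OF lipschitz_on_heat[OF g(1,3)],
              of "B (tm n (Suc k)) \<omega>" 0 "t - tm n (Suc k)"]
          by (simp add: dist_real_def)
        moreover have "L * \<bar>B (tm n (Suc k)) \<omega>\<bar> \<le> L * e'"
          using calculation(1) r(3) L by (intro mult_left_mono) auto
        ultimately show "\<bar>heat (t - tm n (Suc k)) g (B (tm n (Suc k)) \<omega>)\<bar> \<le> L * e'"
          by linarith
      qed
      then show ?thesis
        using e'(2) by linarith
    qed
    then show "\<exists>N. \<forall>n\<ge>N. norm (R n \<omega> - 0) < e"
      by auto
  qed
  obtain \<omega>0 where "\<omega>0 \<in> space M"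
    using not_empty by auto
  then have K: "0 \<le> K"
    using Z(2)[of \<omega>0] by linarith
  have integrable_ZI: "integrable M (\<lambda>\<omega>. Z \<omega> * (I n k \<omega> * g' (B r \<omega>)))"
    if [measurable]: "g' \<in> borel_measurable borel" "B r \<in> borel_measurable M"
      and bdd: "\<And>y. \<bar>g' y\<bar> \<le> C" for n k g' r
  proof (rule integrable_const_bound[of _ "K * (1 * C)"])
    show "AE \<omega> in M. norm (Z \<omega> * (I n k \<omega> * g' (B r \<omega>))) \<le> K * (1 * C)"
      unfolding real_norm_def abs_mult using Z(2) I_nonneg I_le bdd K C
      by (intro AE_I2 mult_mono) auto
  qed measurable
  have eq: "expectation (\<lambda>\<omega>. Z \<omega> * (indicator (hit_by t - hit_by s) \<omega> * g (B t \<omega>))) =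
      expectation (\<lambda>\<omega>. Z \<omega> * R n \<omega>)" for n
  proof -
    have "expectation (\<lambda>\<omega>. Z \<omega> * (indicator (hit_by t - hit_by s) \<omega> * g (B t \<omega>))) =
        expectation (\<lambda>\<omega>. \<Sum>k<Suc n. Z \<omega> * (I n k \<omega> * g (B t \<omega>)))"
      unfolding I_sum[of n, symmetric] sum_distrib_left sum_distrib_right ..
    also have "\<dots> = (\<Sum>k<Suc n. expectation (\<lambda>\<omega>. Z \<omega> * (I n k \<omega> * g (B t \<omega>))))"
      using g(3) by (intro Bochner_Integration.integral_sum integrable_ZI) auto
    also have "\<dots> = (\<Sum>k<Suc n. expectation (\<lambda>\<omega>. Z \<omega> *
        (I n k \<omega> * heat (t - tm n (Suc k)) g (B (tm n (Suc k)) \<omega>))))"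
    proof (rule sum.cong[OF refl])
      fix k assume k: "k \<in> {..<Suc n}"
      have "expectation (\<lambda>\<omega>. Z \<omega> * I n k \<omega> * g (B t \<omega>)) =
          expectation (\<lambda>\<omega>. Z \<omega> * I n k \<omega> * heat (t - tm n (Suc k)) g (B (tm n (Suc k)) \<omega>))"
      proof (rule expectation_markov)
        show "(\<lambda>\<omega>. Z \<omega> * I n k \<omega>) \<in> borel_measurable (past (tm n (Suc k)))"
          using measurable_past_mono[OF Z(1) tm_range(1)] I_past by (rule borel_measurable_times)
        show "\<bar>Z \<omega> * I n k \<omega>\<bar> \<le> K * 1" if "\<omega> \<in> space M" for \<omega>
          unfolding abs_mult using Z(2)[OF that] I_nonneg[of n k \<omega>] I_le[of n k \<omega>] K
          by (intro mult_mono) auto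
        show "tm n (Suc k) \<le> t"
          using k by (intro tm_le) auto
      qed (use tm_range g(3) in auto)
      then show "expectation (\<lambda>\<omega>. Z \<omega> * (I n k \<omega> * g (B t \<omega>))) = expectation (\<lambda>\<omega>. Z \<omega> *
        (I n k \<omega> * heat (t - tm n (Suc k)) g (B (tm n (Suc k)) \<omega>)))"
        by (simp add: mult.assoc)
    qed
    also have "\<dots> = expectation (\<lambda>\<omega>. \<Sum>k<Suc n. Z \<omega> *
        (I n k \<omega> * heat (t - tm n (Suc k)) g (B (tm n (Suc k)) \<omega>)))"
      using g(3)
      by (intro Bochner_Integration.integral_sum[symmetric] integrable_ZI abs_heat_le) auto
    also have "\<dots> = expectation (\<lambda>\<omega>. Z \<omega> * R n \<omega>)"
      unfolding R_def sum_distrib_left ..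
    finally show ?thesis .
  qed
  \<comment> \<open>The expectations of \<open>Z * R n\<close> all equal the left-hand side of the
    claim, so a constant sequence tends to 0.\<close>
  have "(\<lambda>n. expectation (\<lambda>\<omega>. Z \<omega> * R n \<omega>)) \<longlonglongrightarrow> expectation (\<lambda>\<omega>. Z \<omega> * 0)"
  proof (rule integral_dominated_convergence[of _ _ _ "\<lambda>_. K * C"])
    show "AE \<omega> in M. (\<lambda>n. Z \<omega> * R n \<omega>) \<longlonglongrightarrow> Z \<omega> * 0"
      using R_lim by (intro AE_I2 tendsto_mult_left)
    show "AE \<omega> in M. norm (Z \<omega> * R n \<omega>) \<le> K * C" for n
      using Z(2) R_bound K by (intro AE_I2) (auto simp: abs_mult intro!: mult_mono)
  qed auto
  then show ?thesis
    unfolding eq[symmetric] by (simp add: LIMSEQ_const_iff)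
qed

end

section \<open>The path before a surviving or hitting time\<close>

lemma lipschitz_on_mult_bounded:
  fixes f g :: "real \<Rightarrow> real"
  assumes f: "L1-lipschitz_on UNIV f" "\<And>y. \<bar>f y\<bar> \<le> C1"
    and g: "L2-lipschitz_on UNIV g" "\<And>y. \<bar>g y\<bar> \<le> C2"
  shows "(C1 * L2 + L1 * C2)-lipschitz_on UNIV (\<lambda>y. f y * g y)"
proof (rule lipschitz_onI)
  have C: "0 \<le> C1" "0 \<le> C2"
    using f(2)[of 0] g(2)[of 0] by linarith+
  show "0 \<le> C1 * L2 + L1 * C2"
    using C lipschitz_on_nonneg[OF f(1)] lipschitz_on_nonneg[OF g(1)] by simp
  fix a b :: real
  have "f a * g a - f b * g b = f a * (g a - g b) + (f a - f b) * g b"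
    by (simp add: algebra_simps)
  then have "\<bar>f a * g a - f b * g b\<bar> \<le> \<bar>f a\<bar> * \<bar>g a - g b\<bar> + \<bar>f a - f b\<bar> * \<bar>g b\<bar>"
    by (metis abs_mult abs_triangle_ineq)
  also have "\<dots> \<le> C1 * (L2 * \<bar>a - b\<bar>) + (L1 * \<bar>a - b\<bar>) * C2"
    using C f(2) g(2) lipschitz_onD[OF f(1), of a b] lipschitz_onD[OF g(1), of a b]
      lipschitz_on_nonneg[OF f(1)] lipschitz_on_nonneg[OF g(1)]
    by (intro add_mono mult_mono) (auto simp: dist_real_def)
  finally show "dist (f a * g a) (f b * g b) \<le> (C1 * L2 + L1 * C2) * dist a b"
    by (simp add: dist_real_def algebra_simps)
qed

text \<open>An odd, bounded, Lipschitz approximation of \<open>sgn\<close>, which itself is not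
  admissible in the reflection argument.\<close>

definition ramp :: "nat \<Rightarrow> real \<Rightarrow> real" where
  "ramp m y = max (- 1) (min 1 (real m * y))"

lemma lipschitz_on_ramp: "(real m)-lipschitz_on UNIV (ramp m)"
proof (rule lipschitz_onI)
  fix a b :: real
  have "\<bar>ramp m a - ramp m b\<bar> \<le> \<bar>real m * a - real m * b\<bar>"
    by (auto simp: ramp_def max_def min_def)
  also have "\<dots> = real m * \<bar>a - b\<bar>"
    by (simp add: right_diff_distrib[symmetric] abs_mult)
  finally show "dist (ramp m a) (ramp m b) \<le> real m * dist a b"
    by (simp add: dist_real_def)
qed simp

lemma abs_ramp_le: "\<bar>ramp m y\<bar> \<le> 1"
  by (auto simp: ramp_def)

lemma ramp_uminus: "ramp m (- y) = - ramp m y"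
  by (auto simp: ramp_def max_def min_def)

lemma borel_measurable_ramp [measurable]: "ramp m \<in> borel_measurable borel"
  unfolding ramp_def[abs_def] by measurable

lemma ramp_tendsto_sgn: "(\<lambda>m. ramp m y) \<longlonglongrightarrow> sgn y"
proof (rule tendsto_eventually)
  obtain N where N: "1 < real N * \<bar>y\<bar>" if "y \<noteq> 0"
    using reals_Archimedean3[of "\<bar>y\<bar>"] by (cases "y = 0") auto
  show "\<forall>\<^sub>F m in sequentially. ramp m y = sgn y"
  proof (rule eventually_sequentiallyI)
    fix m assume "N \<le> m"
    then have le: "real N * \<bar>y\<bar> \<le> real m * \<bar>y\<bar>"
      by (intro mult_right_mono) auto
    show "ramp m y = sgn y"
    proof (cases y "0 :: real" rule: linorder_cases)
      case less
      then have "real m * y \<le> - 1"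
        using N[OF less_imp_neq[OF less]] le
        unfolding abs_of_neg[OF less] mult_minus_right by linarith
      then show ?thesis
        using less by (simp add: ramp_def)
    next
      case greater
      then have "1 \<le> real m * y"
        using N[OF less_imp_neq[OF greater, symmetric]] le
        unfolding abs_of_pos[OF greater] by linarith
      then show ?thesis
        using greater by (simp add: ramp_def)
    qed (simp add: ramp_def)
  qed
qed

context pinned_brownian_motion
begin

text \<open>The whole space splits into survivors, paths hitting by time \<open>s\<close>, and paths
  hitting in \<open>(s, t]\<close>. The last two classes contribute 0 by reflection, so the
  survivors carry the full unrestricted expectation, which the Markov property evaluates.\<close>

lemma expectation_survive_odd:
  assumes "0 < x" "0 \<le> s" "s \<le> t"
    and f: "L1-lipschitz_on UNIV f" "\<And>y. f (- y) = f y" "\<And>y. \<bar>f y\<bar> \<le> C1"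
    and g: "L2-lipschitz_on UNIV g" "\<And>y. g (- y) = - g y" "\<And>y. \<bar>g y\<bar> \<le> C2"
  shows "expectation (\<lambda>\<omega>. f (B s \<omega>) * (indicator (space M - hit_by t) \<omega> * g (B t \<omega>))) =
    heat s (\<lambda>y. f y * heat (t - s) g y) x"
proof -
  have [measurable]: "f \<in> borel_measurable borel" "g \<in> borel_measurable borel"
    using f(1) g(1) by (auto intro!: borel_measurable_continuous_onI lipschitz_on_continuous_on)
  have [measurable]: "B s \<in> borel_measurable M" "B t \<in> borel_measurable M"
    using assms by (auto intro!: random_variable)
  have [measurable]: "hit_by s \<in> events" "hit_by t \<in> events"
    using assms by (auto intro!: events_hit_by)
  have C: "0 \<le> C1" "0 \<le> C2"
    using f(3)[of 0] g(3)[of 0] by linarith+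
  \<comment> \<open>The product is odd because \<open>f\<close> is even and the heat flow preserves
    the oddness of \<open>g\<close>; it is also bounded and Lipschitz, hence admissible for
    reflection at time \<open>s\<close>.\<close>
  define h where "h y = f y * heat (t - s) g y" for y
  have h_bdd: "\<bar>h y\<bar> \<le> C1 * C2" for y
    unfolding h_def abs_mult using C f(3) g(3) by (intro mult_mono abs_heat_le) auto
  have h_odd: "h (- y) = - h y" for y
    using f(2) heat_uminus[of g, OF _ g(2)] by (simp add: h_def)
  have h_lip: "(C1 * L2 + L1 * C2)-lipschitz_on UNIV h"
    unfolding h_def[abs_def] using f(1,3) g(1,3)
    by (intro lipschitz_on_mult_bounded lipschitz_on_heat abs_heat_le) auto
  have [measurable]: "h \<in> borel_measurable borel"
    unfolding h_def by measurable
  have f_past: "(\<lambda>\<omega>. f (B s \<omega>)) \<in> borel_measurable (past s)"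
    using measurable_past_B[of s s] assms(2) by (auto intro: measurable_compose)
  have ind_past: "indicator (hit_by s) \<in> borel_measurable (past s)"
    using assms(2) by (intro borel_measurable_indicator sets_past_hit_by)
  have hit_by_0: "hit_by 0 = {}"
    using \<open>0 < x\<close> by (auto simp: hit_by_def pinned)
  have 1: "expectation (\<lambda>\<omega>. f (B s \<omega>) * g (B t \<omega>)) = heat s h x"
  proof -
    have "expectation (\<lambda>\<omega>. f (B s \<omega>) * g (B t \<omega>)) =
        expectation (\<lambda>\<omega>. f (B s \<omega>) * heat (t - s) g (B s \<omega>))"
      using assms(2,3) f_past f(3) g(3) by (intro expectation_markov) auto
    also have "\<dots> = expectation (\<lambda>\<omega>. 1 * h (B s \<omega>))"
      by (simp add: h_def)
    also have "\<dots> = expectation (\<lambda>\<omega>. 1 * heat (s - 0) h (B 0 \<omega>))"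
      using assms(2) h_bdd by (intro expectation_markov[of _ _ _ 1]) auto
    also have "\<dots> = expectation (\<lambda>\<omega>. heat s h x)"
      by (intro Bochner_Integration.integral_cong) (auto simp: pinned)
    finally show ?thesis
      using prob_space by simp
  qed
  have 2: "expectation (\<lambda>\<omega>. f (B s \<omega>) * indicator (hit_by s) \<omega> * g (B t \<omega>)) = 0"
  proof -
    have "expectation (\<lambda>\<omega>. f (B s \<omega>) * indicator (hit_by s) \<omega> * g (B t \<omega>)) =
        expectation (\<lambda>\<omega>. f (B s \<omega>) * indicator (hit_by s) \<omega> * heat (t - s) g (B s \<omega>))"
    proof (rule expectation_markov)
      show "(\<lambda>\<omega>. f (B s \<omega>) * indicator (hit_by s) \<omega>) \<in> borel_measurable (past s)"
        using f_past ind_past by (rule borel_measurable_times)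
      show "\<bar>f (B s \<omega>) * indicator (hit_by s) \<omega>\<bar> \<le> C1" for \<omega>
        using f(3) C by (auto split: split_indicator)
    qed (use assms(2,3) g(3) in auto)
    \<comment> \<open>Since the start is \<open>x > 0\<close>, no path has hit at time 0, so a hit
      by time \<open>s\<close> is a hit in \<open>(0, s]\<close> and reflection applies with weight
      1.\<close>
    also have "\<dots> = expectation (\<lambda>\<omega>. 1 * (indicator (hit_by s - hit_by 0) \<omega> * h (B s \<omega>)))"
      by (simp add: h_def hit_by_0 mult_ac)
    also have "\<dots> = 0"
      using assms(2) h_lip h_odd h_bdd by (intro expectation_reflection[of _ _ _ 1]) auto
    finally show ?thesis .
  qed
  have 3: "expectation (\<lambda>\<omega>. f (B s \<omega>) * (indicator (hit_by t - hit_by s) \<omega> * g (B t \<omega>))) = 0"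
    using assms(2,3) f_past f(3) g by (intro expectation_reflection) auto
  have int: "integrable M (\<lambda>\<omega>. f (B s \<omega>) * (indicator A \<omega> * g (B t \<omega>)))" if [measurable]: "A \<in> events" for A
    using f(3) g(3) C by (intro integrable_const_bound[of _ "C1 * (1 * C2)"])
      (auto simp: abs_mult simp del: mult_1 intro!: mult_mono AE_I2 split: split_indicator)
  have "expectation (\<lambda>\<omega>. f (B s \<omega>) * (indicator (space M - hit_by t) \<omega> * g (B t \<omega>))) =
      expectation (\<lambda>\<omega>. f (B s \<omega>) * (indicator (space M) \<omega> * g (B t \<omega>))
        - f (B s \<omega>) * (indicator (hit_by s) \<omega> * g (B t \<omega>))
        - f (B s \<omega>) * (indicator (hit_by t - hit_by s) \<omega> * g (B t \<omega>)))"
    using hit_by_mono[OF assms(3)]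
    by (intro Bochner_Integration.integral_cong) (auto split: split_indicator)
  also have "\<dots> = expectation (\<lambda>\<omega>. f (B s \<omega>) * (indicator (space M) \<omega> * g (B t \<omega>)))
        - expectation (\<lambda>\<omega>. f (B s \<omega>) * (indicator (hit_by s) \<omega> * g (B t \<omega>)))
        - expectation (\<lambda>\<omega>. f (B s \<omega>) * (indicator (hit_by t - hit_by s) \<omega> * g (B t \<omega>)))"
    by (subst Bochner_Integration.integral_diff, (intro Bochner_Integration.integrable_diff int; simp),
        (intro int; simp), subst Bochner_Integration.integral_diff) (auto intro!: int)
  also have "expectation (\<lambda>\<omega>. f (B s \<omega>) * (indicator (space M) \<omega> * g (B t \<omega>))) = heat s h x"
    unfolding 1[symmetric] by (intro Bochner_Integration.integral_cong) auto
  finally show ?thesis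
    using 2 3 by (simp add: mult.assoc h_def[abs_def])
qed

lemma survivor_pos:
  assumes "0 < x" "0 \<le> t" "\<omega> \<in> space M - hit_by t"
  shows "0 < B t \<omega>"
proof (rule ccontr)
  assume "\<not> 0 < B t \<omega>"
  then have "\<exists>r\<ge>0. r \<le> t \<and> B r \<omega> = 0"
    using assms by (intro IVT2' continuous_on_subset[OF continuous_paths]) (auto simp: pinned)
  then show False
    using assms(3) by (auto simp: hit_by_def)
qed

text \<open>A surviving path is positive at time \<open>t\<close>, so inserting
  \<open>sgn (B t \<omega>)\<close> changes nothing; approximating this factor by ramps leads back
  to odd Lipschitz functions.\<close>

lemma expectation_survive:
  assumes "0 < x" "0 \<le> s" "s \<le> t"
    and f: "L-lipschitz_on UNIV f" "\<And>y. f (- y) = f y" "\<And>y. \<bar>f y\<bar> \<le> C"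
  shows "expectation (\<lambda>\<omega>. f (B s \<omega>) * indicator (space M - hit_by t) \<omega>) =
    heat s (\<lambda>y. f y * heat (t - s) sgn y) x"
proof -
  have [measurable]: "f \<in> borel_measurable borel"
    using f(1) by (auto intro!: borel_measurable_continuous_onI lipschitz_on_continuous_on)
  have [measurable]: "B s \<in> borel_measurable M" "B t \<in> borel_measurable M"
    using assms by (auto intro!: random_variable)
  have [measurable]: "hit_by t \<in> events"
    using assms by (auto intro!: events_hit_by)
  have C: "0 \<le> C"
    using f(3)[of 0] by linarith
  have eq: "f (B s \<omega>) * indicator (space M - hit_by t) \<omega> =
      f (B s \<omega>) * (indicator (space M - hit_by t) \<omega> * sgn (B t \<omega>))" for \<omega>
    using survivor_pos[OF assms(1), of t \<omega>] assms(2,3) by (auto split: split_indicator)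
  have "(\<lambda>m. expectation (\<lambda>\<omega>. f (B s \<omega>) * (indicator (space M - hit_by t) \<omega> * ramp m (B t \<omega>))))
      \<longlonglongrightarrow> expectation (\<lambda>\<omega>. f (B s \<omega>) * indicator (space M - hit_by t) \<omega>)"
    unfolding eq
  proof (rule integral_dominated_convergence[of _ _ _ "\<lambda>_. C * (1 * 1)"])
    show "AE \<omega> in M. (\<lambda>m. f (B s \<omega>) * (indicator (space M - hit_by t) \<omega> * ramp m (B t \<omega>)))
        \<longlonglongrightarrow> f (B s \<omega>) * (indicator (space M - hit_by t) \<omega> * sgn (B t \<omega>))"
      by (intro AE_I2 tendsto_mult_left ramp_tendsto_sgn)
    show "AE \<omega> in M. norm (f (B s \<omega>) * (indicator (space M - hit_by t) \<omega> * ramp m (B t \<omega>)))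
        \<le> C * (1 * 1)" for m
      unfolding real_norm_def abs_mult using f(3) C
      by (intro AE_I2 mult_mono abs_ramp_le) (auto split: split_indicator)
  qed auto
  moreover have "expectation (\<lambda>\<omega>. f (B s \<omega>) * (indicator (space M - hit_by t) \<omega> * ramp m (B t \<omega>))) =
      heat s (\<lambda>y. f y * heat (t - s) (ramp m) y) x" for m
    by (rule expectation_survive_odd[OF assms lipschitz_on_ramp ramp_uminus abs_ramp_le])
  moreover have "(\<lambda>m. heat s (\<lambda>y. f y * heat (t - s) (ramp m) y) x) \<longlonglongrightarrow>
      heat s (\<lambda>y. f y * heat (t - s) sgn y) x"
  proof (rule heat_tendsto[where C="C * 1"])
    show "\<bar>f y * heat (t - s) (ramp m) y\<bar> \<le> C * 1" for m y
      unfolding abs_mult using f(3) C abs_ramp_le by (intro mult_mono abs_heat_le) auto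
    show "(\<lambda>m. f y * heat (t - s) (ramp m) y) \<longlonglongrightarrow> f y * heat (t - s) sgn y" for y
      using abs_ramp_le ramp_tendsto_sgn by (intro tendsto_mult_left heat_tendsto) auto
  qed measurable
  ultimately show ?thesis
    using LIMSEQ_unique by simp
qed

lemma expectation_hit_between:
  assumes "0 < x" "0 \<le> s" "s \<le> t" "t \<le> t'"
    and f: "L-lipschitz_on UNIV f" "\<And>y. f (- y) = f y" "\<And>y. \<bar>f y\<bar> \<le> C"
  shows "expectation (\<lambda>\<omega>. f (B s \<omega>) * indicator (hit_by t' - hit_by t) \<omega>) =
    heat s (\<lambda>y. f y * (heat (t - s) sgn y - heat (t' - s) sgn y)) x"
proof -
  have [measurable]: "f \<in> borel_measurable borel"
    using f(1) by (auto intro!: borel_measurable_continuous_onI lipschitz_on_continuous_on)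
  have [measurable]: "B s \<in> borel_measurable M"
    using assms by (auto intro!: random_variable)
  have [measurable]: "hit_by t \<in> events" "hit_by t' \<in> events"
    using assms by (auto intro!: events_hit_by)
  have C: "0 \<le> C"
    using f(3)[of 0] by linarith
  have int: "integrable M (\<lambda>\<omega>. f (B s \<omega>) * indicator A \<omega>)" if [measurable]: "A \<in> events" for A
    using f(3) C by (intro integrable_const_bound[of _ C]) (auto intro!: AE_I2 split: split_indicator)
  have bdd: "\<bar>f y * heat r sgn y\<bar> \<le> C * 1" for r y
    unfolding abs_mult using f(3) C by (intro mult_mono abs_heat_le) (auto simp: abs_sgn_eq)
  have "expectation (\<lambda>\<omega>. f (B s \<omega>) * indicator (hit_by t' - hit_by t) \<omega>) =
    expectation (\<lambda>\<omega>. f (B s \<omega>) * indicator (space M - hit_by t) \<omega>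
      - f (B s \<omega>) * indicator (space M - hit_by t') \<omega>)"
    using hit_by_mono[OF assms(4)] sets.sets_into_space[of "hit_by t'" M]
    by (intro Bochner_Integration.integral_cong) (auto split: split_indicator)
  also have "\<dots> = heat s (\<lambda>y. f y * heat (t - s) sgn y) x - heat s (\<lambda>y. f y * heat (t' - s) sgn y) x"
  proof (subst Bochner_Integration.integral_diff)
    have "s \<le> t'"
      using assms(3,4) by simp
    from expectation_survive[OF assms(1,2) assms(3) f] expectation_survive[OF assms(1,2) this f]
    show "expectation (\<lambda>\<omega>. f (B s \<omega>) * indicator (space M - hit_by t) \<omega>) -
        expectation (\<lambda>\<omega>. f (B s \<omega>) * indicator (space M - hit_by t') \<omega>) =
        heat s (\<lambda>y. f y * heat (t - s) sgn y) x - heat s (\<lambda>y. f y * heat (t' - s) sgn y) x"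
      by simp
  qed (intro int; simp)+
  also have "\<dots> = heat s (\<lambda>y. f y * (heat (t - s) sgn y - heat (t' - s) sgn y)) x"
    unfolding heat_def[of s] right_diff_distrib
    using bdd by (intro Bochner_Integration.integral_diff[symmetric]
        integrable_gauss_bounded[of _ "C * 1"]) auto
  finally show ?thesis .
qed

end

subsection \<open>Discretising the hitting time\<close>

text \<open>Cells are open on the left and closed on the right, in agreement with the differences
  \<open>hit_by t' - hit_by t\<close>; hence ceiling minus 1 rather than floor.\<close>

definition cell :: "nat \<Rightarrow> real \<Rightarrow> nat" where
  "cell n r = nat (\<lceil>real (Suc n) * r\<rceil> - 1)"

lemma cell_unique:
  assumes "0 < r"
  shows "r \<in> {real k / real (Suc n)<..real (Suc k) / real (Suc n)} \<longleftrightarrow> k = cell n r"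
proof -
  have "0 < real (Suc n) * r"
    using assms by simp
  then have "0 < \<lceil>real (Suc n) * r\<rceil>"
    by simp
  then have "k = cell n r \<longleftrightarrow> \<lceil>real (Suc n) * r\<rceil> = int k + 1"
    by (auto simp: cell_def)
  also have "\<dots> \<longleftrightarrow> real k < real (Suc n) * r \<and> real (Suc n) * r \<le> real (Suc k)"
    by (auto simp: ceiling_eq_iff)
  also have "\<dots> \<longleftrightarrow> r \<in> {real k / real (Suc n)<..real (Suc k) / real (Suc n)}"
    by (simp add: divide_less_eq le_divide_eq mult.commute del: of_nat_Suc)
  finally show ?thesis by simp
qed

lemma suminf_cell:
  fixes a :: "nat \<Rightarrow> ennreal"
  shows "(\<Sum>k. indicator {real k / real (Suc n)<..real (Suc k) / real (Suc n)} r * a k) =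
    (if 0 < r then a (cell n r) else 0)"
proof (cases "0 < r")
  case True
  have "(\<Sum>k. indicator {real k / real (Suc n)<..real (Suc k) / real (Suc n)} r * a k) =
      (\<Sum>k\<in>{cell n r}. indicator {real k / real (Suc n)<..real (Suc k) / real (Suc n)} r * a k)"
    using cell_unique[OF True, of _ n] by (intro suminf_finite) (auto simp: indicator_def)
  then show ?thesis
    using cell_unique[OF True, of "cell n r" n] True by (simp del: of_nat_Suc greaterThanAtMost_iff)
next
  case False
  then have "r \<le> real k / real (Suc n)" for k
    using order_trans[of r 0 "real k / real (Suc n)"] by simp
  then have "r \<notin> {real k / real (Suc n)<..real (Suc k) / real (Suc n)}" for k
    by (simp add: not_less del: of_nat_Suc)
  then have "(\<lambda>k. indicator {real k / real (Suc n)<..real (Suc k) / real (Suc n)} r * a k) = (\<lambda>_. 0)"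
    by (auto simp: indicator_def)
  then show ?thesis
    using False by simp
qed

lemma cell_tendsto:
  assumes "0 < r"
  shows "(\<lambda>n. real (cell n r) / real (Suc n)) \<longlonglongrightarrow> r"
proof (rule tendsto_sandwich)
  have c: "real (cell n r) / real (Suc n) < r" "r \<le> real (Suc (cell n r)) / real (Suc n)" for n
    using cell_unique[OF assms, of "cell n r" n] by auto
  have "r - 1 / real (Suc n) \<le> real (cell n r) / real (Suc n)" for n
    using c(2)[of n] by (simp add: add_divide_distrib)
  then show "\<forall>\<^sub>F n in sequentially. r - 1 / real (Suc n) \<le> real (cell n r) / real (Suc n)"
    by auto
  show "\<forall>\<^sub>F n in sequentially. real (cell n r) / real (Suc n) \<le> r"
    using c(1) by (intro always_eventually allI less_imp_le)
  show "(\<lambda>n. r - 1 / real (Suc n)) \<longlonglongrightarrow> r"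
    by real_asymp
qed simp

lemma eventually_cell_pos:
  assumes "0 < r"
  shows "\<forall>\<^sub>F n in sequentially. cell n r \<noteq> 0"
  using order_tendstoD(1)[OF cell_tendsto[OF assms] assms]
  by (rule eventually_mono) (auto intro!: gr0I)

text \<open>Only the sampling time is discretised, the hitting time \<open>r\<close> stays exact.
  Since \<open>0 < u < 1\<close>, both \<open>u * r\<close> and \<open>r - u * r\<close> are
  positive and the singularities of the kernels are avoided.\<close>

lemma killed_mult_hit_tendsto:
  assumes "0 < u" "u < 1" "0 < r" "t \<longlonglongrightarrow> r"
  shows "(\<lambda>n. killed_density (u * t n) x y * hit_density (r - u * t n) y) \<longlonglongrightarrow>
    killed_density (u * r) x y * hit_density ((1 - u) * r) y"
proof -
  have "u * r \<noteq> 0" "(r - u * r) \<noteq> 0" "r - u * r = (1 - u) * r" "0 < r - u * r"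
    using assms by (auto simp: algebra_simps)
  moreover have "(\<lambda>n. killed_density (u * t n) x y * hit_density (r - u * t n) y) \<longlonglongrightarrow>
    killed_density (u * r) x y * hit_density (r - u * r) y"
    unfolding killed_density_def hit_density_def normal_density_def
    using calculation assms by (intro tendsto_intros) auto
  ultimately show ?thesis by simp
qed

section \<open>The lower bound for even Lipschitz test functions\<close>

context pinned_brownian_motion
begin

text \<open>The joint law of \<open>B s\<close> and a first zero in \<open>(t, t']\<close>, with the
  survival difference expanded as a time integral of the hitting density. The gap
  \<open>s < t\<close> keeps \<open>r - s\<close> away from 0.\<close>

lemma nn_integral_hit_between:
  assumes "0 < x" "0 < s" "s < t" "t \<le> t'"
    and f: "L-lipschitz_on UNIV f" "\<And>y. f (- y) = f y" "\<And>y. 0 \<le> f y" "\<And>y. f y \<le> C"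
  shows "(\<integral>\<^sup>+\<omega>. indicator (hit_by t' - hit_by t) \<omega> * ennreal (f (B s \<omega>)) \<partial>M) =
    (\<integral>\<^sup>+y. \<integral>\<^sup>+r. indicator {t<..t'} r *
      (indicator {0<..} y * ennreal (f y * (killed_density s x y * hit_density (r - s) y)))
      \<partial>lborel \<partial>lborel)"
proof -
  have [measurable]: "f \<in> borel_measurable borel"
    using f(1) by (auto intro!: borel_measurable_continuous_onI lipschitz_on_continuous_on)
  have [measurable]: "B s \<in> borel_measurable M"
    using assms by (auto intro!: random_variable)
  have [measurable]: "hit_by t \<in> events" "hit_by t' \<in> events"
    using assms by (auto intro!: events_hit_by)
  have abs_f: "\<bar>f y\<bar> \<le> C" for y
    using f(3,4) by simp
  have C: "0 \<le> C"
    using abs_f[of 0] by linarith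
  define h where "h y = f y * (heat (t - s) sgn y - heat (t' - s) sgn y)" for y
  have [measurable]: "h \<in> borel_measurable borel"
    unfolding h_def by measurable
  have h_odd: "h (- y) = - h y" for y
    using heat_uminus[of sgn, OF _ sgn_minus] f(2) by (simp add: h_def algebra_simps)
  have h_bdd: "\<bar>h y\<bar> \<le> C * 2" for y
  proof -
    have "\<bar>heat r sgn y\<bar> \<le> 1" for r y
      by (intro abs_heat_le) (auto simp: abs_sgn_eq)
    from this[of "t - s" y] this[of "t' - s" y]
    show ?thesis
      unfolding h_def abs_mult using C abs_f by (intro mult_mono) auto
  qed
  have heat_le: "heat (t' - s) sgn y \<le> heat (t - s) sgn y" if "0 < y" for y
    using assms that by (intro heat_sgn_diff(2)) auto
  have "(\<integral>\<^sup>+\<omega>. indicator (hit_by t' - hit_by t) \<omega> * ennreal (f (B s \<omega>)) \<partial>M) =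
      (\<integral>\<^sup>+\<omega>. ennreal (f (B s \<omega>) * indicator (hit_by t' - hit_by t) \<omega>) \<partial>M)"
    by (intro nn_integral_cong) (auto split: split_indicator)
  also have "\<dots> = ennreal (expectation (\<lambda>\<omega>. f (B s \<omega>) * indicator (hit_by t' - hit_by t) \<omega>))"
    using f(3) abs_f C
    by (intro nn_integral_eq_integral integrable_const_bound[of _ C])
      (auto intro!: AE_I2 split: split_indicator)
  also have "\<dots> = ennreal (heat s h x)"
    using assms abs_f by (subst expectation_hit_between) (auto simp: h_def[abs_def])
  also have "\<dots> = ennreal (\<integral>y. indicator {0<..} y * (killed_density s x y * h y) \<partial>lborel)"
    by (subst heat_odd_eq_killed(2)[of s h, OF \<open>0 < s\<close> _ h_odd h_bdd]) auto
  also have "\<dots> = (\<integral>\<^sup>+y. ennreal (indicator {0<..} y * (killed_density s x y * h y)) \<partial>lborel)"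
  proof (rule nn_integral_eq_integral[symmetric])
    show "integrable lborel (\<lambda>y. indicator {0<..} y * (killed_density s x y * h y))"
      by (rule heat_odd_eq_killed(1)[of s h, OF \<open>0 < s\<close> _ h_odd h_bdd]) auto
    show "AE y in lborel. 0 \<le> indicator {0<..} y * (killed_density s x y * h y)"
      using f(3) heat_le assms(1,2)
      by (intro AE_I2) (auto simp: h_def killed_density_nonneg split: split_indicator)
  qed
  also have "\<dots> = (\<integral>\<^sup>+y. \<integral>\<^sup>+r. indicator {t<..t'} r *
      (indicator {0<..} y * ennreal (f y * (killed_density s x y * hit_density (r - s) y)))
      \<partial>lborel \<partial>lborel)"
  proof (intro nn_integral_cong)
    fix y :: real
    show "ennreal (indicator {0<..} y * (killed_density s x y * h y)) =
      (\<integral>\<^sup>+r. indicator {t<..t'} r *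
        (indicator {0<..} y * ennreal (f y * (killed_density s x y * hit_density (r - s) y))) \<partial>lborel)"
    proof (cases "0 < y")
      case True
      have nonneg: "0 \<le> f y * killed_density s x y"
        using True assms f(3) by (simp add: killed_density_nonneg)
      have "ennreal (indicator {0<..} y * (killed_density s x y * h y)) =
          ennreal (f y * killed_density s x y) * ennreal (heat (t - s) sgn y - heat (t' - s) sgn y)"
        using True heat_le[OF True] nonneg by (subst ennreal_mult[symmetric]) (auto simp: h_def mult_ac)
      also have "\<dots> = ennreal (f y * killed_density s x y) *
          (\<integral>\<^sup>+r. indicator {t<..t'} r * ennreal (hit_density (r - s) y) \<partial>lborel)"
        using nn_integral_hit_density_shift[OF assms(3,4) True] by simp
      also have "\<dots> = (\<integral>\<^sup>+r. ennreal (f y * killed_density s x y) *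
          (indicator {t<..t'} r * ennreal (hit_density (r - s) y)) \<partial>lborel)"
        by (rule nn_integral_cmult[symmetric]) measurable
      also have "\<dots> = (\<integral>\<^sup>+r. indicator {t<..t'} r *
        (indicator {0<..} y * ennreal (f y * (killed_density s x y * hit_density (r - s) y))) \<partial>lborel)"
      proof (intro nn_integral_cong)
        fix r :: real
        show "ennreal (f y * killed_density s x y) *
            (indicator {t<..t'} r * ennreal (hit_density (r - s) y)) = indicator {t<..t'} r *
            (indicator {0<..} y * ennreal (f y * (killed_density s x y * hit_density (r - s) y)))"
          using True nonneg assms(3)
          by (auto simp: ennreal_mult[symmetric] hit_density_nonneg mult_ac split: split_indicator)
      qed
      finally show ?thesis .
    qed simp
  qed
  finally show ?thesis .
qed

lemma nn_integral_fraction_density_le: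
  assumes "0 < x" "0 < u" "u < 1"
    and f: "L-lipschitz_on UNIV f" "\<And>y. f (- y) = f y" "\<And>y. 0 \<le> f y" "\<And>y. f y \<le> C"
  shows "(\<integral>\<^sup>+y. ennreal (f y) * ennreal (fraction_density u x y) \<partial>lborel) \<le>
    (\<integral>\<^sup>+\<omega>. ennreal (f (value_at_fraction_of_hitting_time B u \<omega>)) \<partial>M)"
proof -
  define T where "T \<omega> = real_of_ereal (hitting_time B 0 \<omega>)" for \<omega>
  define g where "g n k = real k / real (Suc n)" for n k
  \<comment> \<open>The cell \<open>k = 0\<close> is discarded, since its sampling time is 0, where
    the killed kernel degenerates. The limit does not notice: every \<open>r > 0\<close> eventually
    leaves that cell.\<close>
  define P where "P n k \<omega> = (if k = 0 then 0 else ennreal (f (B (u * g n k) \<omega>)))" for n k \<omega>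
  define Q where "Q n k y r = (if k = 0 then 0 else indicator {0<..} y *
    ennreal (f y * (killed_density (u * g n k) x y * hit_density (r - u * g n k) y)))" for n k y r
  define A where "A n \<omega> = (\<Sum>k. indicator {g n k<..g n (Suc k)} (T \<omega>) * P n k \<omega>)" for n \<omega>
  define D where "D n y r = (\<Sum>k. indicator {g n k<..g n (Suc k)} r * Q n k y r)" for n y r
  define E where "E y r = indicator {0<..} y * (indicator {0<..} r *
    ennreal (f y * (killed_density (u * r) x y * hit_density ((1 - u) * r) y)))" for y r
  \<comment> \<open>Paths without a zero have \<open>T \<omega> = 0\<close> and are counted as 0
    here; as \<open>f \<ge> 0\<close>, this only lowers the integral.\<close>
  define A' where "A' \<omega> = (if 0 < T \<omega> then ennreal (f (B (u * T \<omega>) \<omega>)) else 0)" for \<omega>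
  have cont_f: "continuous_on UNIV f"
    using f(1) by (rule lipschitz_on_continuous_on)
  have [measurable]: "f \<in> borel_measurable borel"
    using cont_f by (rule borel_measurable_continuous_onI)
  have g_nonneg: "0 \<le> g n k" for n k
    by (simp add: g_def)
  have [measurable]: "B (u * g n k) \<in> borel_measurable M" for n k
    using g_nonneg assms by (intro random_variable) auto
  have [measurable]: "T \<in> borel_measurable M"
    unfolding T_def by measurable
  have T_nonneg: "0 \<le> T \<omega>" if "\<omega> \<in> space M" for \<omega>
    unfolding T_def using that by (rule hitting_time_nonneg)
  have [measurable]: "(\<lambda>\<omega>. B (u * T \<omega>) \<omega>) \<in> borel_measurable M"
    using T_nonneg assms by (intro measurable_random_time) auto
  have [measurable]: "P n k \<in> borel_measurable M" for n k
    unfolding P_def by (cases "k = 0") auto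
  have [measurable]: "A n \<in> borel_measurable M" for n
    unfolding A_def by measurable
  have [measurable]: "A' \<in> borel_measurable M"
    unfolding A'_def by measurable
  have [measurable]: "(\<lambda>(y, r). Q n k y r) \<in> borel_measurable (borel \<Otimes>\<^sub>M borel)" for n k
    unfolding Q_def by (cases "k = 0") auto
  have [measurable]: "(\<lambda>(y, r). D n y r) \<in> borel_measurable (borel \<Otimes>\<^sub>M borel)" for n
    unfolding D_def split_beta by measurable
  have [measurable]: "(\<lambda>(y, r). E y r) \<in> borel_measurable (borel \<Otimes>\<^sub>M borel)"
    unfolding E_def split_beta by measurable
  have int_eq: "(\<integral>\<^sup>+\<omega>. A n \<omega> \<partial>M) = (\<integral>\<^sup>+y. \<integral>\<^sup>+r. D n y r \<partial>lborel \<partial>lborel)" for n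
  proof -
    have "(\<integral>\<^sup>+\<omega>. A n \<omega> \<partial>M) = (\<Sum>k. \<integral>\<^sup>+\<omega>. indicator {g n k<..g n (Suc k)} (T \<omega>) * P n k \<omega> \<partial>M)"
      unfolding A_def by (intro nn_integral_suminf) measurable
    also have "\<dots> = (\<Sum>k. \<integral>\<^sup>+y. \<integral>\<^sup>+r. indicator {g n k<..g n (Suc k)} r * Q n k y r \<partial>lborel \<partial>lborel)"
    proof (intro suminf_cong)
      fix k
      show "(\<integral>\<^sup>+\<omega>. indicator {g n k<..g n (Suc k)} (T \<omega>) * P n k \<omega> \<partial>M) =
        (\<integral>\<^sup>+y. \<integral>\<^sup>+r. indicator {g n k<..g n (Suc k)} r * Q n k y r \<partial>lborel \<partial>lborel)"
      proof (cases "k = 0")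
        case False
        \<comment> \<open>This rules out the default branch of \<open>hitting_time_le_iff\<close>:
          lying in some \<open>hit_by t\<close> excludes having no zero at all.\<close>
        have never: "\<exists>n. \<omega> \<in> hit_by (real n)" if "\<omega> \<in> hit_by t" for \<omega> t
        proof -
          obtain n where "t \<le> real n"
            using real_arch_simple by blast
          then show ?thesis
            using hit_by_mono that by blast
        qed
        have "(\<integral>\<^sup>+\<omega>. indicator {g n k<..g n (Suc k)} (T \<omega>) * P n k \<omega> \<partial>M) =
          (\<integral>\<^sup>+\<omega>. indicator (hit_by (g n (Suc k)) - hit_by (g n k)) \<omega> * ennreal (f (B (u * g n k) \<omega>)) \<partial>M)"
        proof (intro nn_integral_cong)
          fix \<omega> assume \<omega>: "\<omega> \<in> space M"
          have "T \<omega> \<in> {g n k<..g n (Suc k)} \<longleftrightarrow> \<omega> \<in> hit_by (g n (Suc k)) - hit_by (g n k)"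
            unfolding greaterThanAtMost_iff not_le[symmetric] T_def
              hitting_time_le_iff[OF \<omega> g_nonneg] using never by blast
          then show "indicator {g n k<..g n (Suc k)} (T \<omega>) * P n k \<omega> =
            indicator (hit_by (g n (Suc k)) - hit_by (g n k)) \<omega> * ennreal (f (B (u * g n k) \<omega>))"
            using False by (auto simp: P_def indicator_def)
        qed
        also have "\<dots> = (\<integral>\<^sup>+y. \<integral>\<^sup>+r. indicator {g n k<..g n (Suc k)} r * (indicator {0<..} y *
          ennreal (f y * (killed_density (u * g n k) x y * hit_density (r - u * g n k) y))) \<partial>lborel \<partial>lborel)"
        proof (rule nn_integral_hit_between[OF assms(1) _ _ _ f])
          have "0 < g n k"
            using False by (simp add: g_def)
          then show "0 < u * g n k" "u * g n k < g n k"
            using assms by auto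
          show "g n k \<le> g n (Suc k)"
            by (simp add: g_def divide_right_mono)
        qed
        finally show ?thesis
          using False by (simp add: Q_def)
      qed (simp add: P_def Q_def)
    qed
    also have "\<dots> = (\<integral>\<^sup>+y. (\<Sum>k. \<integral>\<^sup>+r. indicator {g n k<..g n (Suc k)} r * Q n k y r \<partial>lborel) \<partial>lborel)"
      by (intro nn_integral_suminf[symmetric]) measurable
    also have "\<dots> = (\<integral>\<^sup>+y. \<integral>\<^sup>+r. D n y r \<partial>lborel \<partial>lborel)"
      unfolding D_def by (intro nn_integral_cong nn_integral_suminf[symmetric]) measurable
    finally show ?thesis .
  qed
  have A_eq: "A n \<omega> = (if 0 < T \<omega> then P n (cell n (T \<omega>)) \<omega> else 0)" for n \<omega>
    unfolding A_def g_def by (rule suminf_cell)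
  have D_eq: "D n y r = (if 0 < r then Q n (cell n r) y r else 0)" for n y r
    unfolding D_def g_def by (rule suminf_cell)
  have cell_lim: "(\<lambda>n. g n (cell n r)) \<longlonglongrightarrow> r" if "0 < r" for r
    unfolding g_def using that by (rule cell_tendsto)
  have "(\<lambda>n. \<integral>\<^sup>+\<omega>. A n \<omega> \<partial>M) \<longlonglongrightarrow> (\<integral>\<^sup>+\<omega>. A' \<omega> \<partial>M)"
  proof (rule nn_integral_dominated_convergence[where w="\<lambda>_. ennreal C"])
    \<comment> \<open>On the probability side each path lies in at most one cell, so
      \<open>C\<close> dominates and the limit is exact. Fatou is needed only on the analytic
      side.\<close>
    show "AE \<omega> in M. A n \<omega> \<le> ennreal C" for n
      using f(4) by (intro AE_I2) (simp add: A_eq P_def ennreal_leI)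
    show "(\<integral>\<^sup>+\<omega>. ennreal C \<partial>M) < \<infinity>"
      by (simp add: emeasure_space_1)
    show "AE \<omega> in M. (\<lambda>n. A n \<omega>) \<longlonglongrightarrow> A' \<omega>"
    proof (rule AE_I2)
      fix \<omega> assume \<omega>: "\<omega> \<in> space M"
      show "(\<lambda>n. A n \<omega>) \<longlonglongrightarrow> A' \<omega>"
      proof (cases "0 < T \<omega>")
        case True
        have "(\<lambda>n. B (u * g n (cell n (T \<omega>))) \<omega>) \<longlonglongrightarrow> B (u * T \<omega>) \<omega>"
          using True assms g_nonneg
          by (intro continuous_on_tendsto_compose[OF continuous_paths[OF \<omega>]] tendsto_mult_left cell_lim) auto
        then have "(\<lambda>n. f (B (u * g n (cell n (T \<omega>))) \<omega>)) \<longlonglongrightarrow> f (B (u * T \<omega>) \<omega>)"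
          by (intro continuous_on_tendsto_compose[OF cont_f]) auto
        then have "(\<lambda>n. ennreal (f (B (u * g n (cell n (T \<omega>))) \<omega>))) \<longlonglongrightarrow> A' \<omega>"
          using True by (simp add: A'_def tendsto_ennrealI)
        moreover have "\<forall>\<^sub>F n in sequentially. ennreal (f (B (u * g n (cell n (T \<omega>))) \<omega>)) = A n \<omega>"
          using eventually_cell_pos[OF True] by (rule eventually_mono) (simp add: A_eq True P_def)
        ultimately show ?thesis
          by (rule Lim_transform_eventually)
      qed (simp add: A_eq A'_def)
    qed
  qed measurable
  then have lim_A: "liminf (\<lambda>n. \<integral>\<^sup>+\<omega>. A n \<omega> \<partial>M) = (\<integral>\<^sup>+\<omega>. A' \<omega> \<partial>M)"
    by (intro lim_imp_Liminf) auto
  have E_le: "E y r \<le> liminf (\<lambda>n. D n y r)" for y r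
  proof (cases "0 < r \<and> 0 < y")
    case True
    have "(\<lambda>n. killed_density (u * g n (cell n r)) x y * hit_density (r - u * g n (cell n r)) y)
        \<longlonglongrightarrow> killed_density (u * r) x y * hit_density ((1 - u) * r) y"
      using assms(2,3) True cell_lim by (intro killed_mult_hit_tendsto) auto
    then have "(\<lambda>n. ennreal (f y * (killed_density (u * g n (cell n r)) x y *
        hit_density (r - u * g n (cell n r)) y))) \<longlonglongrightarrow> E y r"
      unfolding E_def using True by (simp add: tendsto_ennrealI tendsto_mult_left)
    moreover have "\<forall>\<^sub>F n in sequentially. ennreal (f y * (killed_density (u * g n (cell n r)) x y *
        hit_density (r - u * g n (cell n r)) y)) = D n y r"
      using eventually_cell_pos[of r] True by (auto elim!: eventually_mono simp: D_eq Q_def)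
    ultimately have "(\<lambda>n. D n y r) \<longlonglongrightarrow> E y r"
      by (rule Lim_transform_eventually)
    then show ?thesis
      by (simp add: lim_imp_Liminf)
  qed (auto simp: E_def)
  have "(\<integral>\<^sup>+y. ennreal (f y) * ennreal (fraction_density u x y) \<partial>lborel) \<le>
      (\<integral>\<^sup>+y. \<integral>\<^sup>+r. E y r \<partial>lborel \<partial>lborel)"
  proof (intro nn_integral_mono)
    fix y :: real
    show "ennreal (f y) * ennreal (fraction_density u x y) \<le> (\<integral>\<^sup>+r. E y r \<partial>lborel)"
    proof (cases "0 < y")
      case True
      have "ennreal (f y) * ennreal (fraction_density u x y) \<le> ennreal (f y) *
        (\<integral>\<^sup>+r. indicator {0<..} r *
          ennreal (killed_density (u * r) x y * hit_density ((1 - u) * r) y) \<partial>lborel)"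
        using fraction_density_le_nn_integral[OF assms(1-3) True] by (rule mult_left_mono) simp
      also have "\<dots> = (\<integral>\<^sup>+r. ennreal (f y) * (indicator {0<..} r *
          ennreal (killed_density (u * r) x y * hit_density ((1 - u) * r) y)) \<partial>lborel)"
        by (rule nn_integral_cmult[symmetric]) measurable
      also have "\<dots> = (\<integral>\<^sup>+r. E y r \<partial>lborel)"
      proof (intro nn_integral_cong)
        fix r :: real
        show "ennreal (f y) * (indicator {0<..} r *
          ennreal (killed_density (u * r) x y * hit_density ((1 - u) * r) y)) = E y r"
          using True assms f(3)
          by (auto simp: E_def ennreal_mult killed_density_nonneg hit_density_nonneg
              split: split_indicator)
      qed
      finally show ?thesis .
    qed (simp add: fraction_density_def)
  qed
  also have "\<dots> \<le> (\<integral>\<^sup>+y. \<integral>\<^sup>+r. liminf (\<lambda>n. D n y r) \<partial>lborel \<partial>lborel)"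
    by (intro nn_integral_mono E_le)
  \<comment> \<open>Fatou in \<open>r\<close>, and in the next step Fatou in
    \<open>y\<close>.\<close>
  also have "\<dots> \<le> (\<integral>\<^sup>+y. liminf (\<lambda>n. \<integral>\<^sup>+r. D n y r \<partial>lborel) \<partial>lborel)"
    by (intro nn_integral_mono nn_integral_liminf) measurable
  also have "\<dots> \<le> liminf (\<lambda>n. \<integral>\<^sup>+y. \<integral>\<^sup>+r. D n y r \<partial>lborel \<partial>lborel)"
    by (intro nn_integral_liminf) measurable
  also have "\<dots> = (\<integral>\<^sup>+\<omega>. A' \<omega> \<partial>M)"
    unfolding int_eq[symmetric] by (rule lim_A)
  also have "\<dots> \<le> (\<integral>\<^sup>+\<omega>. ennreal (f (value_at_fraction_of_hitting_time B u \<omega>)) \<partial>M)"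
    by (intro nn_integral_mono)
      (simp add: A'_def value_at_fraction_of_hitting_time_def T_def)
  finally show ?thesis .
qed

section \<open>From the inequality to equality of the laws\<close>

lemma value_at_fraction_pos:
  assumes "0 < x" "0 < u" "u < 1" "\<omega> \<in> space M"
  shows "0 < value_at_fraction_of_hitting_time B u \<omega>"
proof (rule ccontr)
  define T where "T = real_of_ereal (hitting_time B 0 \<omega>)"
  assume "\<not> 0 < value_at_fraction_of_hitting_time B u \<omega>"
  then have le: "B (u * T) \<omega> \<le> 0"
    by (simp add: value_at_fraction_of_hitting_time_def T_def)
  have T: "0 \<le> T"
    using hitting_time_nonneg[OF assms(4)] by (simp add: T_def)
  \<comment> \<open>A nonpositive value would force a zero no later than \<open>u * T\<close>, hence
    \<open>T \<le> u * T\<close> and \<open>T = 0\<close>, which contradicts the start at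
    \<open>x > 0\<close>.\<close>
  then have "\<exists>r\<ge>0. r \<le> u * T \<and> B r \<omega> = 0"
    using assms le
    by (intro IVT2' continuous_on_subset[OF continuous_paths]) (auto simp: pinned)
  then obtain r where r: "0 \<le> r" "r \<le> u * T" "B r \<omega> = 0"
    by auto
  then have "T \<le> u * T"
    using first_zero_attained(3)[OF assms(4) r(1,3) r(1,3)] by (simp add: T_def)
  then have "(1 - u) * T \<le> 0"
    by (simp add: algebra_simps)
  then have "T = 0"
    using T assms(3) by (simp add: mult_le_0_iff)
  then show False
    using le assms(1,4) by (simp add: pinned)
qed

text \<open>Transfers the bound from functions to sets: positivity sets of 1-Lipschitz functions
  include the open half lines, which determine a distribution on the line.\<close>

lemma emeasure_fraction_density_le:
  fixes \<phi> :: "real \<Rightarrow> real"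
  assumes "0 < x" "0 < u" "u < 1" and \<phi>: "1-lipschitz_on UNIV \<phi>"
  shows "(\<integral>\<^sup>+y. ennreal (fraction_density u x y) * indicator {y. 0 < \<phi> y} y \<partial>lborel) \<le>
    emeasure M {\<omega> \<in> space M. 0 < \<phi> (value_at_fraction_of_hitting_time B u \<omega>)}"
proof -
  define X where "X = value_at_fraction_of_hitting_time B u"
  \<comment> \<open>The absolute value makes \<open>f m\<close> even without changing it at
    \<open>X \<omega> > 0\<close>. The slope \<open>m\<close> lets \<open>f m\<close> approach the
    indicator of the positivity set on \<open>y > 0\<close>, and the density ignores the
    rest.\<close>
  define f where "f m y = max 0 (ramp m (\<phi> \<bar>y\<bar>))" for m y
  have [measurable]: "\<phi> \<in> borel_measurable borel"
    using \<phi> by (auto intro!: borel_measurable_continuous_onI lipschitz_on_continuous_on)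
  have [measurable]: "X \<in> borel_measurable M"
    unfolding X_def using assms by (intro measurable_value_at_fraction) simp
  have [measurable]: "f m \<in> borel_measurable borel" for m
    unfolding f_def by measurable
  have X_pos: "0 < X \<omega>" if "\<omega> \<in> space M" for \<omega>
    unfolding X_def using assms that by (intro value_at_fraction_pos)
  have f_range: "0 \<le> f m y" "f m y \<le> 1" for m y
    using abs_ramp_le[of m "\<phi> \<bar>y\<bar>"] by (auto simp: f_def)
  have f_lip: "(real m)-lipschitz_on UNIV (f m)" for m
  proof (rule lipschitz_onI)
    fix a b :: real
    have "\<bar>f m a - f m b\<bar> \<le> \<bar>ramp m (\<phi> \<bar>a\<bar>) - ramp m (\<phi> \<bar>b\<bar>)\<bar>"
      by (auto simp: f_def max_def)
    also have "\<dots> \<le> real m * \<bar>\<phi> \<bar>a\<bar> - \<phi> \<bar>b\<bar>\<bar>"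
      using lipschitz_onD[OF lipschitz_on_ramp, of "\<phi> \<bar>a\<bar>" "\<phi> \<bar>b\<bar>" m] by (simp add: dist_real_def)
    also have "\<dots> \<le> real m * \<bar>a - b\<bar>"
      using lipschitz_onD[OF \<phi>, of "\<bar>a\<bar>" "\<bar>b\<bar>"] abs_triangle_ineq3[of a b]
      by (intro mult_left_mono) (auto simp: dist_real_def)
    finally show "dist (f m a) (f m b) \<le> real m * dist a b"
      by (simp add: dist_real_def)
  qed simp
  have f_lim: "(\<lambda>m. f m y) \<longlonglongrightarrow> indicator {y. 0 < \<phi> y} y" if "0 < y" for y
  proof -
    have "(\<lambda>m. f m y) \<longlonglongrightarrow> max 0 (sgn (\<phi> \<bar>y\<bar>))"
      unfolding f_def by (intro tendsto_max tendsto_const ramp_tendsto_sgn)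
    moreover have "max 0 (sgn (\<phi> \<bar>y\<bar>)) = indicator {y. 0 < \<phi> y} y"
      using that by (auto simp: sgn_if indicator_def)
    ultimately show ?thesis by simp
  qed
  have f_le: "f m (X \<omega>) \<le> indicator {\<omega> \<in> space M. 0 < \<phi> (X \<omega>)} \<omega>" if "\<omega> \<in> space M" for m \<omega>
  proof (cases "0 < \<phi> (X \<omega>)")
    case False
    then have "real m * \<phi> (X \<omega>) \<le> 0"
      by (simp add: mult_nonneg_nonpos)
    then have "f m (X \<omega>) = 0"
      using X_pos[OF that] by (auto simp: f_def ramp_def)
    then show ?thesis by simp
  qed (use that f_range(2) in simp)
  have bound: "(\<integral>\<^sup>+y. ennreal (f m y) * ennreal (fraction_density u x y) \<partial>lborel) \<le>
      emeasure M {\<omega> \<in> space M. 0 < \<phi> (X \<omega>)}" for m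
  proof -
    have "(\<integral>\<^sup>+y. ennreal (f m y) * ennreal (fraction_density u x y) \<partial>lborel) \<le>
        (\<integral>\<^sup>+\<omega>. ennreal (f m (X \<omega>)) \<partial>M)"
      unfolding X_def using f_range
      by (intro nn_integral_fraction_density_le[OF assms(1-3) f_lip, where C=1]) (auto simp: f_def)
    also have "\<dots> \<le> (\<integral>\<^sup>+\<omega>. indicator {\<omega> \<in> space M. 0 < \<phi> (X \<omega>)} \<omega> \<partial>M)"
    proof (intro nn_integral_mono)
      fix \<omega> assume "\<omega> \<in> space M"
      then show "ennreal (f m (X \<omega>)) \<le> indicator {\<omega> \<in> space M. 0 < \<phi> (X \<omega>)} \<omega>"
        using ennreal_leI[OF f_le[of \<omega> m]] by (simp add: ennreal_indicator)
    qed
    also have "\<dots> = emeasure M {\<omega> \<in> space M. 0 < \<phi> (X \<omega>)}"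
      by (intro nn_integral_indicator) measurable
    finally show ?thesis .
  qed
  have "(\<integral>\<^sup>+y. ennreal (fraction_density u x y) * indicator {y. 0 < \<phi> y} y \<partial>lborel) =
      (\<integral>\<^sup>+y. liminf (\<lambda>m. ennreal (f m y) * ennreal (fraction_density u x y)) \<partial>lborel)"
  proof (intro nn_integral_cong)
    fix y :: real
    show "ennreal (fraction_density u x y) * indicator {y. 0 < \<phi> y} y =
      liminf (\<lambda>m. ennreal (f m y) * ennreal (fraction_density u x y))"
    proof (cases "0 < y")
      case True
      have "(\<lambda>m. ennreal (f m y * fraction_density u x y)) \<longlonglongrightarrow>
          ennreal (indicator {y. 0 < \<phi> y} y * fraction_density u x y)"
        by (intro tendsto_ennrealI tendsto_mult_right f_lim True)
      then have "liminf (\<lambda>m. ennreal (f m y * fraction_density u x y)) =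
          ennreal (indicator {y. 0 < \<phi> y} y * fraction_density u x y)"
        by (intro lim_imp_Liminf) auto
      then show ?thesis
        using f_range fraction_density_nonneg[OF assms(1-3)]
        by (simp add: ennreal_mult ennreal_indicator mult.commute)
    qed (simp add: fraction_density_def Liminf_const)
  qed
  also have "\<dots> \<le> liminf (\<lambda>m. \<integral>\<^sup>+y. ennreal (f m y) * ennreal (fraction_density u x y) \<partial>lborel)"
    by (intro nn_integral_liminf) measurable
  also have "\<dots> \<le> liminf (\<lambda>m::nat. emeasure M {\<omega> \<in> space M. 0 < \<phi> (X \<omega>)})"
    using bound by (intro Liminf_mono) auto
  also have "\<dots> = emeasure M {\<omega> \<in> space M. 0 < \<phi> (X \<omega>)}"
    by (simp add: Liminf_const)
  finally show ?thesis
    by (simp add: X_def)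
qed

text \<open>The law dominates the density on open half lines to both sides. As both measures have
  mass 1, domination on one side bounds the complement from above, so the distribution functions
  agree.\<close>

lemma distr_value_at_fraction:
  assumes "0 < x" "0 < u" "u < 1"
  shows "distr M borel (value_at_fraction_of_hitting_time B u) =
    density lborel (\<lambda>y. ennreal (fraction_density u x y))"
proof -
  define X where "X = value_at_fraction_of_hitting_time B u"
  define \<mu> where "\<mu> = distr M borel X"
  define \<nu> where "\<nu> = density lborel (\<lambda>y. ennreal (fraction_density u x y))"
  have X [measurable]: "X \<in> borel_measurable M"
    unfolding X_def using assms by (intro measurable_value_at_fraction) simp
  interpret \<mu>: real_distribution \<mu>
    unfolding \<mu>_def using X by (rule real_distribution_distr)
  interpret \<nu>: prob_space \<nu>
    using nn_integral_fraction_density[OF assms]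
    by (intro prob_spaceI) (simp add: \<nu>_def emeasure_density)
  interpret \<nu>: real_distribution \<nu>
    by (intro real_distribution.intro real_distribution_axioms.intro \<nu>.prob_space_axioms)
      (simp_all add: \<nu>_def)
  have le: "\<nu>.prob {y. 0 < \<phi> y} \<le> \<mu>.prob {y. 0 < \<phi> y}" if \<phi>: "1-lipschitz_on UNIV \<phi>" for \<phi> :: "real \<Rightarrow> real"
  proof -
    have [measurable]: "\<phi> \<in> borel_measurable borel"
      using \<phi> by (auto intro!: borel_measurable_continuous_onI lipschitz_on_continuous_on)
    have "emeasure \<nu> {y. 0 < \<phi> y} \<le> emeasure M {\<omega> \<in> space M. 0 < \<phi> (X \<omega>)}"
      using emeasure_fraction_density_le[OF assms \<phi>]
      by (simp add: \<nu>_def emeasure_density X_def)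
    also have "{\<omega> \<in> space M. 0 < \<phi> (X \<omega>)} = X -` {y. 0 < \<phi> y} \<inter> space M"
      by auto
    also have "emeasure M \<dots> = emeasure \<mu> {y. 0 < \<phi> y}"
      unfolding \<mu>_def by (intro emeasure_distr[symmetric]) measurable
    finally show ?thesis
      by (simp add: \<nu>.emeasure_eq_measure \<mu>.emeasure_eq_measure)
  qed
  have "cdf \<mu> = cdf \<nu>"
  proof
    fix a
    have lip: "1-lipschitz_on UNIV (\<lambda>y::real. y - a)" "1-lipschitz_on UNIV (\<lambda>y::real. a - y)"
      by (auto intro!: lipschitz_onI simp: dist_real_def)
    have compl: "- {a<..} = {..a}"
      by auto
    have "\<nu>.prob {a<..} \<le> \<mu>.prob {a<..}"
      using le[OF lip(1)] by (simp add: greaterThan_def)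
    then have "\<mu>.prob {..a} \<le> \<nu>.prob {..a}"
      using \<mu>.prob_compl[of "{a<..}"] \<nu>.prob_compl[of "{a<..}"]
      by (simp add: Compl_eq_Diff_UNIV[symmetric] compl)
    moreover have "\<nu>.prob {..a} \<le> \<mu>.prob {..a}"
    proof -
      \<comment> \<open>The half line \<open>{..<a}\<close> is open while the distribution function
        uses \<open>{..a}\<close>; the missing point carries no \<open>\<nu>\<close>-mass.\<close>
      have "emeasure \<nu> {a} = 0"
        using AE_lborel_singleton[of a]
        by (auto simp: \<nu>_def emeasure_density nn_integral_0_iff_AE elim!: eventually_mono)
      then have "\<nu>.prob {a} = 0"
        by (simp add: measure_def)
      then have "\<nu>.prob {..a} \<le> \<nu>.prob {..<a}"
        using measure_Un_le[of "{..<a}" \<nu> "{a}"] by (simp add: ivl_disj_un_singleton(2)[symmetric])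
      also have "\<dots> \<le> \<mu>.prob {..<a}"
        using le[OF lip(2)] by (simp add: lessThan_def)
      also have "\<dots> \<le> \<mu>.prob {..a}"
        by (intro \<mu>.finite_measure_mono) auto
      finally show ?thesis .
    qed
    ultimately show "cdf \<mu> a = cdf \<nu> a"
      by (simp add: cdf_def)
  qed
  then have "\<mu> = \<nu>"
    by (intro cdf_unique \<mu>.real_distribution_axioms \<nu>.real_distribution_axioms)
  then show ?thesis
    by (simp add: \<mu>_def \<nu>_def X_def)
qed

end

text \<open>All axioms except the start concern increments and continuity, which a shift constant in
  time leaves alone; so the start can be made exact on every path.\<close>

lemma (in brownian_motion) pinned_shift:
  "pinned_brownian_motion M (\<lambda>t \<omega>. x + (B t \<omega> - B 0 \<omega>)) x"
proof unfold_locales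
  show "(\<lambda>\<omega>. x + (B t \<omega> - B 0 \<omega>)) \<in> borel_measurable M" if "0 \<le> t" for t
    using that by (intro borel_measurable_add borel_measurable_diff random_variable) auto
  show "indep_vars (\<lambda>_. borel) (\<lambda>i \<omega>. x + (B (t (Suc i)) \<omega> - B 0 \<omega>) - (x + (B (t i) \<omega> - B 0 \<omega>))) {..<n}"
    if "0 \<le> t 0" "\<And>i. i < n \<Longrightarrow> t i < t (Suc i)" for t :: "nat \<Rightarrow> real" and n
    using independent_increments[of t n] that by simp
  show "distributed M lborel (\<lambda>\<omega>. x + (B t \<omega> - B 0 \<omega>) - (x + (B s \<omega> - B 0 \<omega>)))
      (\<lambda>y. ennreal (normal_density 0 (sqrt (t - s)) y))" if "0 \<le> s" "s < t" for s t
    using normal_increments[OF that] by simp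
  show "continuous_on {0..} (\<lambda>t. x + (B t \<omega> - B 0 \<omega>))" if "\<omega> \<in> space M" for \<omega>
    by (intro continuous_intros continuous_paths that)
qed auto

theorem theorem1p1:
  fixes M :: "'a measure" and B :: "real \<Rightarrow> 'a \<Rightarrow> real" and x u :: real
  assumes "x > 0" and "0 < u" and "u < 1"
    and "brownian_motion M B x"
  shows "distributed M lborel (value_at_fraction_of_hitting_time B u)
           (\<lambda>y. ennreal (fraction_density u x y))"
proof -
  interpret brownian_motion M B x by fact
  define B' where "B' t \<omega> = x + (B t \<omega> - B 0 \<omega>)" for t \<omega>
  interpret pinned: pinned_brownian_motion M B' x
    unfolding B'_def[abs_def] by (rule pinned_shift)
  have meas: "value_at_fraction_of_hitting_time B u \<in> borel_measurable M"
    "value_at_fraction_of_hitting_time B' u \<in> borel_measurable M"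
    using measurable_value_at_fraction pinned.measurable_value_at_fraction assms(2) by simp_all
  \<comment> \<open>Where \<open>B 0 \<omega> = x\<close>, the two paths agree at all times at once,
    so their hitting times and the values at the random time agree too.\<close>
  have "AE \<omega> in M. value_at_fraction_of_hitting_time B u \<omega> = value_at_fraction_of_hitting_time B' u \<omega>"
    using start
  proof eventually_elim
    case (elim \<omega>)
    then have "B' t \<omega> = B t \<omega>" for t
      by (simp add: B'_def)
    then show ?case
      by (simp add: value_at_fraction_of_hitting_time_def hitting_time_def)
  qed
  then have "distr M borel (value_at_fraction_of_hitting_time B u) =
      distr M borel (value_at_fraction_of_hitting_time B' u)"
    using meas by (intro distr_cong_AE) auto
  also have "\<dots> = density lborel (\<lambda>y. ennreal (fraction_density u x y))"
    using assms(1-3) by (rule pinned.distr_value_at_fraction)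
  finally show ?thesis
    unfolding distributed_def using meas by (simp cong: distr_cong)
qed

end
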